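(* Let $W_0:\mathbb{R}^d\times\mathcal{P}_2(\mathbb{R}^d)\to\mathbb{R}^d$ and $F,G:\mathbb{R}^d\times\mathcal{P}_2(\mathbb{R}^d)\times\mathbb{R}^d\to\mathbb{R}^d$ be continuous. Assume: (1) there is a constant $C_1$ with $|W_0(x,\mu)|+|F(x,\mu,u)|+|G(x,\mu,u)|\le C_1(1+|x|+|u|+\sqrt{E_2(\mu)})$ for all $(x,\mu,u)$; (2) there exist $\alpha>0$, $L\ge0$, $a_0>0$ such that for all $X,Y,U,V\in\mathcal{H}$: $\langle\tilde W_0(X)-\tilde W_0(Y),X-Y\rangle\ge a_0\|\tilde W_0(X)-\tilde W_0(Y)\|^2$; $\langle\tilde G(X,U)-\tilde G(Y,V),X-Y\rangle+\langle\tilde F(X,U)-\tilde F(Y,V),U-V\rangle\ge0$; $\langle\tilde G(X,U)-\tilde G(Y,V),X-Y\rangle+\langle\tilde F(X,U)-\tilde F(Y,V),U-V\rangle\ge\alpha\|X-Y\|^2-L\|U-V\|^2$; (3) there exist $\gamma\in(0,1]$, a constant $C_2$ and a modulus of continuity $\omega$ such that for all $X,Y,U,V\in\mathcal{H}$: $\langle\tilde G(X,U)-\tilde G(Y,V),U-V\rangle\le C_2(\|X-Y\|^2+\|U-V\|^2)$; $\langle\tilde F(X,U)-\tilde F(Y,V),X-Y\rangle\ge-C_2(\|X-Y\|^2+\|U-V\|_\gamma^2)$; and for all $x,u\in\mathbb{R}^d$, $\mu,\nu\in\mathcal{P}_2(\mathbb{R}^d)$: $|F(x,\mu,u)-F(x,\nu,u)|+|G(x,\mu,u)-G(x,\nu,u)|+|W_0(x,\mu)-W_0(x,\nu)|\le\omega(\mathcal{W}_2(\mu,\nu))$.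 Then there exists a constant $C$ such that, whenever $(X,W^x,Z^x)$ and $(Y,W^y,Z^y)$ are strong solutions on $[0,T]$ of $$X_t=X_0-\int_0^t\tilde F(X_s,W_s)ds+\sigma_xB_t,\qquad W_t=\tilde W_0(X_T)+\int_t^T\tilde G(X_s,W_s)ds-\int_t^TZ_sdB_s$$ with initial data $X_0\in\mathcal{H}$ and $Y_0\in\mathcal{H}$ respectively, $$\forall t\le T,\quad\|W^x_t-W^y_t\|\le C\|X_0-Y_0\|.$$
   Context: Fix $d\ge1$, $T>0$, $\sigma_x\ge0$ and a sufficiently rich probability space. $\mathcal{H}=L^2(\Omega,\mathbb{R}^d)$ with $\langle X,Y\rangle=\mathbb{E}[X\cdot Y]$, norm $\|\cdot\|$; $\|X-Y\|_\gamma=\max(\|X-Y\|,\|X-Y\|^\gamma)$; $\mathcal{L}(X)$ is the law of $X$; $\mathcal{P}_2(\mathbb{R}^d)$ carries $\mathcal{W}_2$; $E_2(\mu)=\int|y|^2\mu(dy)$. A modulus of continuity is a continuous increasing $\omega:\mathbb{R}^+\to\mathbb{R}^+$ with $\omega(0)=0$. Lifts: $\tilde W_0(X)=W_0(X,\mathcal{L}(X))$, $\tilde F(X,U)=F(X,\mathcal{L}(X),U)$, $\tilde G(X,U)=G(X,\mathcal{L}(X),U)$. $B$ is a $d$-dimensional Brownian motion (the same for both solutions) with respect to a filtration for which $X_0,Y_0$ are measurable at time $0$. A strong solution is a triple of adapted, square integrable processes (with $X_t,W_t\in\mathcal{H}$ and $Z$ square integrable with respect to $dt\otimes\mathbb{P}$)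 satisfying the system. The constant $C$ depends only on the data ($F,G,W_0,T$), not on the solutions. *)

theory Defs
  imports "HOL-Probability.Probability"
begin

text \<open>Throughout, \<open>real^'n\<close> is $\mathbb{R}^d$ with $d = $ \<open>CARD('n)\<close>; matrices
  \<open>real^'n^'n\<close> carry the Frobenius norm.\<close>

subsection \<open>Square integrable random variables and their lifts\<close>

definition L2_space :: "'a measure \<Rightarrow> ('a \<Rightarrow> 'b::euclidean_space) set" where
  "L2_space M = {X \<in> borel_measurable M. integrable M (\<lambda>\<omega>. (norm (X \<omega>))\<^sup>2)}"

definition L2_inner :: "'a measure \<Rightarrow> ('a \<Rightarrow> 'b::euclidean_space) \<Rightarrow> ('a \<Rightarrow> 'b) \<Rightarrow> real" where
  "L2_inner M X Y = (\<integral>\<omega>. X \<omega> \<bullet> Y \<omega> \<partial>M)"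

definition L2_norm :: "'a measure \<Rightarrow> ('a \<Rightarrow> 'b::euclidean_space) \<Rightarrow> real" where
  "L2_norm M X = sqrt (L2_inner M X X)"

definition L2_norm_gamma :: "'a measure \<Rightarrow> real \<Rightarrow> ('a \<Rightarrow> 'b::euclidean_space) \<Rightarrow> real" where
  "L2_norm_gamma M \<gamma> X = max (L2_norm M X) (L2_norm M X powr \<gamma>)"

definition law :: "'a measure \<Rightarrow> ('a \<Rightarrow> 'b::euclidean_space) \<Rightarrow> 'b measure" where
  "law M X = distr M borel X"

definition lift0 :: "'a measure \<Rightarrow> ('b::euclidean_space \<Rightarrow> 'b measure \<Rightarrow> 'b) \<Rightarrow> ('a \<Rightarrow> 'b) \<Rightarrow> 'a \<Rightarrow> 'b" where
  "lift0 M W\<^sub>0 X = (\<lambda>\<omega>. W\<^sub>0 (X \<omega>) (law M X))"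

definition lift :: "'a measure \<Rightarrow> ('b::euclidean_space \<Rightarrow> 'b measure \<Rightarrow> 'b \<Rightarrow> 'b) \<Rightarrow>
    ('a \<Rightarrow> 'b) \<Rightarrow> ('a \<Rightarrow> 'b) \<Rightarrow> 'a \<Rightarrow> 'b" where
  "lift M F X U = (\<lambda>\<omega>. F (X \<omega>) (law M X) (U \<omega>))"


subsection \<open>The Wasserstein space\<close>

definition P2 :: "'b::euclidean_space measure set" where
  "P2 = {\<mu>. prob_space \<mu> \<and> sets \<mu> = sets borel \<and> integrable \<mu> (\<lambda>y. (norm y)\<^sup>2)}"

definition E2 :: "'b::euclidean_space measure \<Rightarrow> real" where
  "E2 \<mu> = (\<integral>y. (norm y)\<^sup>2 \<partial>\<mu>)"

definition couplings :: "'b::euclidean_space measure \<Rightarrow> 'b measure \<Rightarrow> ('b \<times> 'b) measure set" where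
  "couplings \<mu> \<nu> = {\<pi>. prob_space \<pi> \<and> sets \<pi> = sets (borel \<Otimes>\<^sub>M borel) \<and>
     distr \<pi> borel fst = \<mu> \<and> distr \<pi> borel snd = \<nu>}"

definition W2 :: "'b::euclidean_space measure \<Rightarrow> 'b measure \<Rightarrow> real" where
  "W2 \<mu> \<nu> = sqrt (INF \<pi>\<in>couplings \<mu> \<nu>. \<integral>z. (dist (fst z) (snd z))\<^sup>2 \<partial>\<pi>)"

text \<open>Joint continuity on $\mathbb{R}^d \times \mathcal{P}_2(\mathbb{R}^d)$, respectively
  $\mathbb{R}^d \times \mathcal{P}_2(\mathbb{R}^d) \times \mathbb{R}^d$, spelled out because
  \<open>P2\<close> is a set of measures metrised by \<open>W2\<close> and not a type of class \<open>metric_space\<close>.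
  Values at measures outside \<open>P2\<close> are irrelevant.\<close>

definition continuous_P2 :: "('b::euclidean_space \<Rightarrow> 'b measure \<Rightarrow> 'b) \<Rightarrow> bool" where
  "continuous_P2 f \<longleftrightarrow> (\<forall>x. \<forall>\<mu>\<in>P2. \<forall>e>0. \<exists>\<delta>>0. \<forall>y. \<forall>\<nu>\<in>P2.
     dist x y < \<delta> \<and> W2 \<mu> \<nu> < \<delta> \<longrightarrow> dist (f x \<mu>) (f y \<nu>) < e)"

definition continuous_P2_2 :: "('b::euclidean_space \<Rightarrow> 'b measure \<Rightarrow> 'b \<Rightarrow> 'b) \<Rightarrow> bool" where
  "continuous_P2_2 f \<longleftrightarrow> (\<forall>x u. \<forall>\<mu>\<in>P2. \<forall>e>0. \<exists>\<delta>>0. \<forall>y v. \<forall>\<nu>\<in>P2.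
     dist x y < \<delta> \<and> W2 \<mu> \<nu> < \<delta> \<and> dist u v < \<delta> \<longrightarrow> dist (f x \<mu> u) (f y \<nu> v) < e)"

definition modulus_of_continuity :: "(real \<Rightarrow> real) \<Rightarrow> bool" where
  "modulus_of_continuity w \<longleftrightarrow>
     continuous_on {0..} w \<and> mono_on {0..} w \<and> (\<forall>r\<ge>0. w r \<ge> 0) \<and> w 0 = 0"


subsection \<open>Brownian motion\<close>

text \<open>The filtration is indexed by all reals because the library locale has a type as index set;
  only times \<open>t \<ge> 0\<close> are used. The usual conditions are not required.\<close>

definition filtered_prob_space :: "'a measure \<Rightarrow> (real \<Rightarrow> 'a measure) \<Rightarrow> bool" where
  "filtered_prob_space M \<F> \<longleftrightarrow>
     prob_space M \<and> filtration (space M) \<F> \<and> (\<forall>t. subalgebra M (\<F> t))"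

definition brownian_motion ::
    "'a measure \<Rightarrow> (real \<Rightarrow> 'a measure) \<Rightarrow> (real \<Rightarrow> 'a \<Rightarrow> real^'n) \<Rightarrow> bool" where
  "brownian_motion M \<F> B \<longleftrightarrow>
     filtered_prob_space M \<F> \<and>
     (\<forall>t\<ge>0. B t \<in> borel_measurable (\<F> t)) \<and>
     (AE \<omega> in M. B 0 \<omega> = 0) \<and>
     (AE \<omega> in M. continuous_on {0..} (\<lambda>t. B t \<omega>)) \<and>
     (\<forall>s t. 0 \<le> s \<and> s < t \<longrightarrow>
        distributed M lborel (\<lambda>\<omega>. B t \<omega> - B s \<omega>)
          (\<lambda>x. ennreal (\<Prod>i\<in>UNIV. normal_density 0 (sqrt (t - s)) (x $ i))) \<and>
        prob_space.indep_set M (sets (\<F> s))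
          {(\<lambda>\<omega>. B t \<omega> - B s \<omega>) -` A \<inter> space M | A. A \<in> sets borel})"


subsection \<open>The Ito integral\<close>

abbreviation time_space :: "real \<Rightarrow> 'a measure \<Rightarrow> (real \<times> 'a) measure" where
  "time_space T M \<equiv> restrict_space lborel {0..T} \<Otimes>\<^sub>M M"

text \<open>A simple process on \<open>[0,T]\<close> is given by \<open>n\<close> intervals with end points
  \<open>p 0 < \<dots> < p n\<close> and the values \<open>\<xi> i\<close> taken on \<open>(p i, p (i+1)]\<close>.\<close>

definition simple_process ::
    "(real \<Rightarrow> 'a measure) \<Rightarrow> real \<Rightarrow> nat \<Rightarrow> (nat \<Rightarrow> real) \<Rightarrow> (nat \<Rightarrow> 'a \<Rightarrow> real^'n^'n) \<Rightarrow> bool" where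
  "simple_process \<F> T n p \<xi> \<longleftrightarrow> p 0 = 0 \<and> p n = T \<and>
     (\<forall>i<n. p i < p (Suc i) \<and> \<xi> i \<in> borel_measurable (\<F> (p i)) \<and>
        bounded (\<xi> i ` space (\<F> (p i))))"

definition simple_value ::
    "nat \<Rightarrow> (nat \<Rightarrow> real) \<Rightarrow> (nat \<Rightarrow> 'a \<Rightarrow> real^'n^'n) \<Rightarrow> real \<Rightarrow> 'a \<Rightarrow> real^'n^'n" where
  "simple_value n p \<xi> t \<omega> = (\<Sum>i<n. indicator {p i<..p (Suc i)} t *\<^sub>R \<xi> i \<omega>)"

definition simple_integral ::
    "(real \<Rightarrow> 'a \<Rightarrow> real^'n) \<Rightarrow> nat \<Rightarrow> (nat \<Rightarrow> real) \<Rightarrow> (nat \<Rightarrow> 'a \<Rightarrow> real^'n^'n) \<Rightarrow>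
      real \<Rightarrow> 'a \<Rightarrow> real^'n" where
  "simple_integral B n p \<xi> t \<omega> =
     (\<Sum>i<n. \<xi> i \<omega> *v (B (min t (p (Suc i))) \<omega> - B (min t (p i)) \<omega>))"

text \<open>\<open>is_ito_integral M \<F> B T Z I\<close>: for every \<open>t\<close> in \<open>[0,T]\<close>, \<open>I t\<close> is a version of
  $\int_0^t Z_s\,dB_s$, the $L^2$ limit of the integrals of simple processes which approximate
  \<open>Z\<close> in $L^2(dt \otimes \mathbb{P})$. A relation, as \<open>I t\<close> is only determined almost surely.\<close>

definition is_ito_integral ::
    "'a measure \<Rightarrow> (real \<Rightarrow> 'a measure) \<Rightarrow> (real \<Rightarrow> 'a \<Rightarrow> real^'n) \<Rightarrow> real \<Rightarrow>
      (real \<Rightarrow> 'a \<Rightarrow> real^'n^'n) \<Rightarrow> (real \<Rightarrow> 'a \<Rightarrow> real^'n) \<Rightarrow> bool" where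
  "is_ito_integral M \<F> B T Z I \<longleftrightarrow>
     (\<lambda>(t, \<omega>). Z t \<omega>) \<in> L2_space (time_space T M) \<and>
     (\<forall>t\<in>{0..T}. I t \<in> L2_space M) \<and>
     (\<exists>n p \<xi>. (\<forall>k. simple_process \<F> T (n k) (p k) (\<xi> k)) \<and>
        (\<lambda>k. L2_norm (time_space T M)
           (\<lambda>(t, \<omega>). simple_value (n k) (p k) (\<xi> k) t \<omega> - Z t \<omega>)) \<longlonglongrightarrow> 0 \<and>
        (\<forall>t\<in>{0..T}. (\<lambda>k. L2_norm M
           (\<lambda>\<omega>. simple_integral B (n k) (p k) (\<xi> k) t \<omega> - I t \<omega>)) \<longlonglongrightarrow> 0))"


subsection \<open>Strong solutions of the forward-backward system\<close>

definition sq_integrable_adapted ::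
    "'a measure \<Rightarrow> (real \<Rightarrow> 'a measure) \<Rightarrow> real \<Rightarrow> (real \<Rightarrow> 'a \<Rightarrow> 'b::euclidean_space) \<Rightarrow> bool" where
  "sq_integrable_adapted M \<F> T X \<longleftrightarrow>
     (\<forall>t\<in>{0..T}. X t \<in> borel_measurable (\<F> t)) \<and>
     (\<lambda>(t, \<omega>). X t \<omega>) \<in> L2_space (time_space T M)"

text \<open>The two integrability conditions on the drifts say that the Lebesgue integrals in the
  system exist (a Bochner integral which does not exist has value 0 in the library). They are no
  restriction for continuous \<open>F\<close> and \<open>G\<close> of linear growth. Both equations hold
  almost surely for each \<open>t\<close>.\<close>

definition strong_solution ::
    "'a measure \<Rightarrow> (real \<Rightarrow> 'a measure) \<Rightarrow> (real \<Rightarrow> 'a \<Rightarrow> real^'n) \<Rightarrow> real \<Rightarrow> real \<Rightarrow>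
      (real^'n \<Rightarrow> (real^'n) measure \<Rightarrow> real^'n) \<Rightarrow>
      (real^'n \<Rightarrow> (real^'n) measure \<Rightarrow> real^'n \<Rightarrow> real^'n) \<Rightarrow>
      (real^'n \<Rightarrow> (real^'n) measure \<Rightarrow> real^'n \<Rightarrow> real^'n) \<Rightarrow>
      ('a \<Rightarrow> real^'n) \<Rightarrow>
      (real \<Rightarrow> 'a \<Rightarrow> real^'n) \<Rightarrow> (real \<Rightarrow> 'a \<Rightarrow> real^'n) \<Rightarrow> (real \<Rightarrow> 'a \<Rightarrow> real^'n^'n) \<Rightarrow> bool" where
  "strong_solution M \<F> B T \<sigma> W\<^sub>0 F G X\<^sub>0 X W Z \<longleftrightarrow>
     sq_integrable_adapted M \<F> T X \<and>
     sq_integrable_adapted M \<F> T W \<and>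
     sq_integrable_adapted M \<F> T Z \<and>
     (\<forall>t\<in>{0..T}. X t \<in> L2_space M \<and> W t \<in> L2_space M) \<and>
     integrable (time_space T M) (\<lambda>(s, \<omega>). lift M F (X s) (W s) \<omega>) \<and>
     integrable (time_space T M) (\<lambda>(s, \<omega>). lift M G (X s) (W s) \<omega>) \<and>
     (\<forall>t\<in>{0..T}. AE \<omega> in M.
        X t \<omega> = X\<^sub>0 \<omega> - (LINT s:{0..t}|lborel. lift M F (X s) (W s) \<omega>) + \<sigma> *\<^sub>R B t \<omega>) \<and>
     (\<exists>I. is_ito_integral M \<F> B T Z I \<and>
        (\<forall>t\<in>{0..T}. AE \<omega> in M.
           W t \<omega> = lift0 M W\<^sub>0 (X T) \<omega> + (LINT s:{t..T}|lborel. lift M G (X s) (W s) \<omega>)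
             - (I T \<omega> - I t \<omega>)))"

end

theory Submission
  imports Defs
begin

text \<open>
  Let \<open>x\<close> and \<open>v\<close> be the differences of the forward and backward components of two solutions,
  and let \<open>f\<close> and \<open>g\<close> be the differences of the lifted coefficients along them. The noise
  \<open>\<sigma>\<^sub>x B\<close> cancels in \<open>x\<close>, so \<open>x\<close> has drift \<open>- f\<close> and no martingale part, whereas \<open>v\<close> has drift
  \<open>- g\<close> and a martingale part. Write $\langle\cdot,\cdot\rangle$ and $\|\cdot\|$ for the inner
  product and norm of $L^2$. The product rule gives
  $$\langle v_0,x_0\rangle = \langle v_T,x_T\rangle
      + \int_0^T \langle g_s,x_s\rangle + \langle f_s,v_s\rangle\,ds, \qquad
    \|v_t\|^2 \le \|v_T\|^2 + 2\int_t^T \langle g_s,v_s\rangle\,ds .$$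
  By monotonicity the integrand $m_s = \langle g_s,x_s\rangle + \langle f_s,v_s\rangle$ of the first
  identity is nonnegative, so the integral over \<open>[0,T]\<close> dominates the one over \<open>[t,T]\<close>. With
  $D = \langle v_0,x_0\rangle$ the first identity then bounds $\|v_T\|^2$ by $D/a_0$, through the
  cocoercivity of the terminal condition, and bounds $\int_t^T\|x_s\|^2\,ds$ by
  $(D + L\int_t^T\|v_s\|^2\,ds)/\alpha$, through strong monotonicity. Inserted in the second one,
  these bounds leave an inequality of Gronwall type for $\|v_t\|^2$, hence $\|v_t\|^2 \le C D$.
  Cauchy-Schwarz gives $D \le \|v_0\|\,\|x_0\|$; at \<open>t = 0\<close> this yields $\|v_0\| \le C\|x_0\|$, and
  then $\|v_t\|^2 \le C^2\|x_0\|^2$ for all \<open>t\<close>. This is \<open>backward_monotone_stability\<close>.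

  No stochastic calculus is needed for the two product formulas. Both are instances of
  \<open>energy_identity\<close>, which concerns processes that are, up to their terminal value, the sum of the
  time integral of an adapted square integrable drift and a process whose increments after \<open>t\<close> are
  orthogonal in $L^2$ to everything measurable at time \<open>t\<close>. Expanding
  $\langle p_T + \int_t^T a, q_T + \int_t^T b\rangle$, the double integral over a square splits into two
  triangles, and these turn the terminal values in
  $\langle p_T, b_s\rangle$ and $\langle a_s, q_T\rangle$ into the values at time \<open>s\<close>. The
  probabilistic input is that the Ito integral has orthogonal future increments
  (\<open>ito_integral_orthogonal_future_increments\<close>), which for simple integrands is the independence
  and centredness of Brownian increments and passes to the $L^2$ limit.
\<close>

section \<open>Square integrable random variables\<close>

lemma L2_space_borel_measurable: "X \<in> L2_space M \<Longrightarrow> X \<in> borel_measurable M"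
  by (simp add: L2_space_def)

lemma L2_space_integrable_norm_sq:
  "X \<in> L2_space M \<Longrightarrow> integrable M (\<lambda>\<omega>. (norm (X \<omega>))\<^sup>2)"
  by (simp add: L2_space_def)

lemma L2_spaceI:
  "X \<in> borel_measurable M \<Longrightarrow> integrable M (\<lambda>\<omega>. (norm (X \<omega>))\<^sup>2) \<Longrightarrow> X \<in> L2_space M"
  by (simp add: L2_space_def)

lemma L2_space_dominated:
  fixes X :: "'a \<Rightarrow> 'b::euclidean_space"
  assumes X: "X \<in> borel_measurable M" and h: "integrable M h"
    and le: "\<And>\<omega>. \<omega> \<in> space M \<Longrightarrow> (norm (X \<omega>))\<^sup>2 \<le> h \<omega>"
  shows "X \<in> L2_space M"
proof (rule L2_spaceI[OF X])
  show "integrable M (\<lambda>\<omega>. (norm (X \<omega>))\<^sup>2)"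
    using X by (intro Bochner_Integration.integrable_bound[OF h])
      (auto intro!: AE_I2 order_trans[OF le abs_ge_self])
qed

lemma L2_space_zero: "(\<lambda>\<omega>. 0) \<in> L2_space M"
  by (simp add: L2_space_def)

lemma norm_add_sq_le: "(norm (a + b :: 'b::real_inner))\<^sup>2 \<le> 2 * (norm a)\<^sup>2 + 2 * (norm b)\<^sup>2"
proof -
  have "0 \<le> (norm (a - b))\<^sup>2" by simp
  then show ?thesis
    by (simp add: power2_norm_eq_inner inner_add_left inner_add_right inner_diff_left
        inner_diff_right inner_commute)
qed

lemma L2_space_add:
  assumes "X \<in> L2_space M" "Y \<in> L2_space M"
  shows "(\<lambda>\<omega>. X \<omega> + Y \<omega>) \<in> L2_space M"
  using assms
  by (intro L2_space_dominated[where h="\<lambda>\<omega>. 2 * (norm (X \<omega>))\<^sup>2 + 2 * (norm (Y \<omega>))\<^sup>2"])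
    (auto simp: L2_space_def norm_add_sq_le)

lemma L2_space_scaleR:
  assumes "X \<in> L2_space M" shows "(\<lambda>\<omega>. c *\<^sub>R X \<omega>) \<in> L2_space M"
  using assms by (auto simp: L2_space_def power_mult_distrib)

lemma L2_space_diff:
  assumes "X \<in> L2_space M" "Y \<in> L2_space M"
  shows "(\<lambda>\<omega>. X \<omega> - Y \<omega>) \<in> L2_space M"
  using L2_space_add[OF assms(1) L2_space_scaleR[OF assms(2), of "-1"]] by simp

lemma L2_space_sum:
  assumes "\<And>i. i \<in> S \<Longrightarrow> X i \<in> L2_space M"
  shows "(\<lambda>\<omega>. \<Sum>i\<in>S. X i \<omega>) \<in> L2_space M"
  using assms by (induction S rule: infinite_finite_induct) (auto intro: L2_space_zero L2_space_add)

lemma abs_inner_le_norm_sq: "\<bar>a \<bullet> b\<bar> \<le> (norm a)\<^sup>2 + (norm (b :: 'b::real_inner))\<^sup>2"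
proof -
  have "\<bar>a \<bullet> b\<bar> \<le> norm a * norm b" by (rule Cauchy_Schwarz_ineq2)
  moreover have "0 \<le> norm a * norm b" by simp
  ultimately show ?thesis using sum_squares_bound[of "norm a" "norm b"] by linarith
qed

lemma integrable_inner_L2:
  assumes "X \<in> L2_space M" "Y \<in> L2_space M"
  shows "integrable M (\<lambda>\<omega>. X \<omega> \<bullet> Y \<omega>)"
proof (rule Bochner_Integration.integrable_bound)
  show "integrable M (\<lambda>\<omega>. (norm (X \<omega>))\<^sup>2 + (norm (Y \<omega>))\<^sup>2)"
    using assms by (auto intro: L2_space_integrable_norm_sq)
  show "(\<lambda>\<omega>. X \<omega> \<bullet> Y \<omega>) \<in> borel_measurable M"
    using assms by (auto dest!: L2_space_borel_measurable)
qed (simp add: abs_inner_le_norm_sq)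

lemma L2_inner_add_left:
  assumes "X \<in> L2_space M" "Y \<in> L2_space M" "Z \<in> L2_space M"
  shows "L2_inner M (\<lambda>\<omega>. X \<omega> + Y \<omega>) Z = L2_inner M X Z + L2_inner M Y Z"
  using assms by (simp add: L2_inner_def inner_add_left integrable_inner_L2)

lemma L2_inner_diff_left:
  assumes "X \<in> L2_space M" "Y \<in> L2_space M" "Z \<in> L2_space M"
  shows "L2_inner M (\<lambda>\<omega>. X \<omega> - Y \<omega>) Z = L2_inner M X Z - L2_inner M Y Z"
  using assms by (simp add: L2_inner_def inner_diff_left integrable_inner_L2)

lemma L2_inner_commute: "L2_inner M X Y = L2_inner M Y X"
  by (simp add: L2_inner_def inner_commute)

lemma L2_inner_add_right:
  assumes "X \<in> L2_space M" "Y \<in> L2_space M" "Z \<in> L2_space M"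
  shows "L2_inner M Z (\<lambda>\<omega>. X \<omega> + Y \<omega>) = L2_inner M Z X + L2_inner M Z Y"
  using L2_inner_add_left[OF assms] by (simp add: L2_inner_commute)

lemma L2_inner_self_nonneg: "0 \<le> L2_inner M X X"
  by (simp add: L2_inner_def)

lemma L2_norm_nonneg: "0 \<le> L2_norm M X"
  by (simp add: L2_norm_def L2_inner_self_nonneg)

lemma L2_norm_sq: "(L2_norm M X)\<^sup>2 = L2_inner M X X"
  by (simp add: L2_norm_def L2_inner_self_nonneg)

lemma L2_inner_cong_AE:
  assumes "AE \<omega> in M. X \<omega> = X' \<omega>" "AE \<omega> in M. Y \<omega> = Y' \<omega>"
    and "X \<in> borel_measurable M" "X' \<in> borel_measurable M"
      "Y \<in> borel_measurable M" "Y' \<in> borel_measurable M"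
  shows "L2_inner M X Y = L2_inner M X' Y'"
  unfolding L2_inner_def using assms by (intro integral_cong_AE) auto

text \<open>The quadratic form \<open>(s, r) \<mapsto> L2_inner M (s X - r Y) (s X - r Y)\<close> is nonnegative. Keeping both
  variables homogeneous allows the choice \<open>(s, r) = (c, b)\<close> or \<open>(b, a)\<close>, according to which of
  the two squared norms is positive.\<close>

lemma L2_Cauchy_Schwarz:
  assumes X: "X \<in> L2_space M" and Y: "Y \<in> L2_space M"
  shows "\<bar>L2_inner M X Y\<bar> \<le> L2_norm M X * L2_norm M Y"
proof -
  define a b c where "a = L2_inner M X X" and "b = L2_inner M X Y" and "c = L2_inner M Y Y"
  have nonneg: "0 \<le> s\<^sup>2 * a - 2 * s * r * b + r\<^sup>2 * c" for s r :: real
  proof -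
    have "0 \<le> (\<integral>\<omega>. (s *\<^sub>R X \<omega> - r *\<^sub>R Y \<omega>) \<bullet> (s *\<^sub>R X \<omega> - r *\<^sub>R Y \<omega>) \<partial>M)"
      by (intro integral_nonneg_AE) auto
    also have "\<dots> = (\<integral>\<omega>. s\<^sup>2 * (X \<omega> \<bullet> X \<omega>) - 2 * s * r * (X \<omega> \<bullet> Y \<omega>) + r\<^sup>2 * (Y \<omega> \<bullet> Y \<omega>) \<partial>M)"
      by (intro Bochner_Integration.integral_cong refl)
        (simp add: inner_diff_left inner_diff_right inner_commute power2_eq_square algebra_simps)
    also have "\<dots> = s\<^sup>2 * a - 2 * s * r * b + r\<^sup>2 * c"
      using integrable_inner_L2[OF X X] integrable_inner_L2[OF X Y] integrable_inner_L2[OF Y Y]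
      by (simp add: a_def b_def c_def L2_inner_def)
    finally show ?thesis .
  qed
  have "b\<^sup>2 \<le> a * c"
  proof (cases "a = 0 \<and> c = 0")
    case True
    have "0 \<le> - 2 * b" "0 \<le> 2 * b" using nonneg[of 1 1] nonneg[of 1 "-1"] True by auto
    then show ?thesis using True by simp
  next
    case False
    have "0 \<le> a" "0 \<le> c" by (simp_all add: a_def c_def L2_inner_self_nonneg)
    then consider "c > 0" | "a > 0" using False by linarith
    then show ?thesis
    proof cases
      case 1
      have "0 \<le> c * (a * c - b\<^sup>2)" using nonneg[of c b] by (simp add: power2_eq_square algebra_simps)
      then show ?thesis using 1 by (simp add: zero_le_mult_iff)
    next
      case 2
      have "0 \<le> a * (a * c - b\<^sup>2)" using nonneg[of b a] by (simp add: power2_eq_square algebra_simps)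
      then show ?thesis using 2 by (simp add: zero_le_mult_iff)
    qed
  qed
  then have "sqrt (b\<^sup>2) \<le> sqrt (a * c)" by (rule real_sqrt_le_mono)
  then show ?thesis by (simp add: a_def b_def c_def L2_norm_def real_sqrt_mult)
qed

section \<open>Time integrals of square integrable processes\<close>

lemma L2_space_dominated_AE:
  fixes X :: "'a \<Rightarrow> 'b::euclidean_space"
  assumes X: "X \<in> borel_measurable M" and h: "integrable M h"
    and le: "AE \<omega> in M. (norm (X \<omega>))\<^sup>2 \<le> h \<omega>"
  shows "X \<in> L2_space M"
proof (rule L2_spaceI[OF X])
  show "integrable M (\<lambda>\<omega>. (norm (X \<omega>))\<^sup>2)"
    using X le by (intro Bochner_Integration.integrable_bound[OF h]) auto
qed

lemma L2_space_const: "finite_measure M \<Longrightarrow> (\<lambda>_. c) \<in> L2_space M"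
  by (auto simp: L2_space_def finite_measure.integrable_const)

lemma L2_space_integrable:
  fixes u :: "'s \<Rightarrow> 'b::euclidean_space"
  assumes N: "finite_measure N" and u: "u \<in> L2_space N"
  shows "integrable N u"
proof -
  have n: "(\<lambda>r. norm (u r)) \<in> L2_space N" using u by (auto simp: L2_space_def)
  have one: "(\<lambda>r. 1::real) \<in> L2_space N" by (rule L2_space_const[OF N])
  have "integrable N (\<lambda>r. norm (u r))" using integrable_inner_L2[OF n one] by simp
  then show ?thesis using u by (auto simp: L2_space_def integrable_norm_iff)
qed

text \<open>On a finite measure space $L^1$ is controlled by $L^2$: this is Cauchy-Schwarz against the
  constant 1.\<close>

lemma norm_set_integral_sq_le:
  fixes u :: "'s \<Rightarrow> 'b::euclidean_space"
  assumes N: "finite_measure N" and u: "u \<in> L2_space N" and A: "A \<in> sets N"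
  shows "(norm (LINT r:A|N. u r))\<^sup>2 \<le> measure N (space N) * (\<integral>r. (norm (u r))\<^sup>2 \<partial>N)"
proof -
  interpret finite_measure N by fact
  have n: "(\<lambda>r. norm (u r)) \<in> L2_space N" using u by (auto simp: L2_space_def)
  have one: "(\<lambda>r. 1::real) \<in> L2_space N" by (rule L2_space_const[OF N])
  have uint: "integrable N u" by (rule L2_space_integrable[OF N u])
  have "norm (LINT r:A|N. u r) \<le> (\<integral>r. norm (indicator A r *\<^sub>R u r) \<partial>N)"
    unfolding set_lebesgue_integral_def by (rule integral_norm_bound)
  also have "\<dots> \<le> (\<integral>r. norm (u r) \<partial>N)"
    using A by (intro integral_mono integrable_norm integrable_mult_indicator uint)
      (auto split: split_indicator)
  also have "\<dots> = L2_inner N (\<lambda>r. norm (u r)) (\<lambda>r. 1)" by (simp add: L2_inner_def)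
  also have "\<dots> \<le> L2_norm N (\<lambda>r. norm (u r)) * L2_norm N (\<lambda>r. 1::real)"
    using L2_Cauchy_Schwarz[OF n one] by linarith
  finally have "(norm (LINT r:A|N. u r))\<^sup>2 \<le> (L2_norm N (\<lambda>r. norm (u r)) * L2_norm N (\<lambda>r. 1::real))\<^sup>2"
    by (rule power_mono) simp
  also have "\<dots> = measure N (space N) * (\<integral>r. (norm (u r))\<^sup>2 \<partial>N)"
    by (simp add: power_mult_distrib L2_norm_sq) (simp add: L2_inner_def power2_eq_square mult.commute)
  finally show ?thesis .
qed

context
  fixes N :: "'s measure" and M :: "'a measure"
  assumes N: "finite_measure N" and M: "finite_measure M"
begin

interpretation N: finite_measure N by (rule N)
interpretation M: finite_measure M by (rule M)
interpretation pair_sigma_finite N M ..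

lemma L2_process_AE_L2_path:
  fixes u :: "'s \<Rightarrow> 'a \<Rightarrow> 'b::euclidean_space"
  assumes "(\<lambda>(r, \<omega>). u r \<omega>) \<in> L2_space (N \<Otimes>\<^sub>M M)"
  shows "AE \<omega> in M. (\<lambda>r. u r \<omega>) \<in> L2_space N"
proof -
  have [measurable]: "(\<lambda>(r, \<omega>). u r \<omega>) \<in> borel_measurable (N \<Otimes>\<^sub>M M)"
    by (rule L2_space_borel_measurable[OF assms])
  have "integrable (N \<Otimes>\<^sub>M M) (\<lambda>(r, \<omega>). (norm (u r \<omega>))\<^sup>2)"
    using L2_space_integrable_norm_sq[OF assms] by (simp add: case_prod_unfold)
  from AE_integrable_snd[OF this] AE_space show ?thesis
    by eventually_elim (auto intro!: L2_spaceI)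
qed

lemma L2_space_time_integral:
  fixes u :: "'s \<Rightarrow> 'a \<Rightarrow> 'b::euclidean_space"
  assumes u: "(\<lambda>(r, \<omega>). u r \<omega>) \<in> L2_space (N \<Otimes>\<^sub>M M)" and A [measurable]: "A \<in> sets N"
  shows "(\<lambda>\<omega>. LINT r:A|N. u r \<omega>) \<in> L2_space M"
proof (rule L2_space_dominated_AE)
  have [measurable]: "(\<lambda>(r, \<omega>). u r \<omega>) \<in> borel_measurable (N \<Otimes>\<^sub>M M)"
    by (rule L2_space_borel_measurable[OF u])
  have "(\<lambda>(\<omega>, r). u r \<omega>) \<in> borel_measurable (M \<Otimes>\<^sub>M N)" by measurable
  then show "(\<lambda>\<omega>. LINT r:A|N. u r \<omega>) \<in> borel_measurable M"
    unfolding set_lebesgue_integral_def by measurable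
  have "integrable (N \<Otimes>\<^sub>M M) (\<lambda>(r, \<omega>). (norm (u r \<omega>))\<^sup>2)"
    using L2_space_integrable_norm_sq[OF u] by (simp add: case_prod_unfold)
  from integrable_snd[OF this]
  show "integrable M (\<lambda>\<omega>. measure N (space N) * (\<integral>r. (norm (u r \<omega>))\<^sup>2 \<partial>N))" by simp
  show "AE \<omega> in M. (norm (LINT r:A|N. u r \<omega>))\<^sup>2 \<le> measure N (space N) * (\<integral>r. (norm (u r \<omega>))\<^sup>2 \<partial>N)"
    using L2_process_AE_L2_path[OF u]
    by eventually_elim (rule norm_set_integral_sq_le[OF N _ A])
qed

lemma integrable_L2_inner_process:
  fixes u v :: "'s \<Rightarrow> 'a \<Rightarrow> 'b::euclidean_space"
  assumes "(\<lambda>(r, \<omega>). u r \<omega>) \<in> L2_space (N \<Otimes>\<^sub>M M)" "(\<lambda>(r, \<omega>). v r \<omega>) \<in> L2_space (N \<Otimes>\<^sub>M M)"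
  shows "integrable N (\<lambda>r. L2_inner M (u r) (v r))"
  unfolding L2_inner_def
  using integrable_inner_L2[OF assms] by (intro integrable_fst) (simp add: case_prod_unfold)

lemma L2_space_const_process:
  fixes Y :: "'a \<Rightarrow> 'b::euclidean_space"
  assumes "Y \<in> L2_space M"
  shows "(\<lambda>(r, \<omega>). Y \<omega>) \<in> L2_space (N \<Otimes>\<^sub>M M)"
proof (rule L2_spaceI)
  have [measurable]: "Y \<in> borel_measurable M" using assms by (rule L2_space_borel_measurable)
  show "(\<lambda>(r, \<omega>). Y \<omega>) \<in> borel_measurable (N \<Otimes>\<^sub>M M)" by measurable
  show "integrable (N \<Otimes>\<^sub>M M) (\<lambda>x. (norm (case x of (r, \<omega>) \<Rightarrow> Y \<omega>))\<^sup>2)"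
    using L2_space_integrable_norm_sq[OF assms] by (intro Fubini_integrable) auto
qed

text \<open>Integration in time is a bounded operation in $L^2$, so it commutes with the functional
  \<open>L2_inner M _ Y\<close>; concretely this is Fubini, and the $L^2$ bound supplies the integrability.\<close>

lemma L2_inner_time_integral:
  fixes u :: "'s \<Rightarrow> 'a \<Rightarrow> 'b::euclidean_space"
  assumes u: "(\<lambda>(r, \<omega>). u r \<omega>) \<in> L2_space (N \<Otimes>\<^sub>M M)" and A [measurable]: "A \<in> sets N"
    and Y: "Y \<in> L2_space M"
  shows "L2_inner M (\<lambda>\<omega>. LINT r:A|N. u r \<omega>) Y = (LINT r:A|N. L2_inner M (u r) Y)"
proof -
  have [measurable]: "(\<lambda>(r, \<omega>). u r \<omega>) \<in> borel_measurable (N \<Otimes>\<^sub>M M)"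
    by (rule L2_space_borel_measurable[OF u])
  have [measurable]: "Y \<in> borel_measurable M" using Y by (rule L2_space_borel_measurable)
  have "integrable (N \<Otimes>\<^sub>M M) (\<lambda>x. (case x of (r, \<omega>) \<Rightarrow> u r \<omega>) \<bullet> (case x of (r, \<omega>) \<Rightarrow> Y \<omega>))"
    by (rule integrable_inner_L2[OF u L2_space_const_process[OF Y]])
  then have "integrable (N \<Otimes>\<^sub>M M) (\<lambda>x. indicator (A \<times> space M) x *\<^sub>R
      ((case x of (r, \<omega>) \<Rightarrow> u r \<omega>) \<bullet> (case x of (r, \<omega>) \<Rightarrow> Y \<omega>)))"
    by (intro integrable_mult_indicator) auto
  also have "?this \<longleftrightarrow> integrable (N \<Otimes>\<^sub>M M) (\<lambda>(r, \<omega>). indicator A r * (u r \<omega> \<bullet> Y \<omega>))"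
    by (intro Bochner_Integration.integrable_cong refl)
      (auto simp: space_pair_measure indicator_times)
  finally have int: "integrable (N \<Otimes>\<^sub>M M) (\<lambda>(r, \<omega>). indicator A r * (u r \<omega> \<bullet> Y \<omega>))" .
  have "L2_inner M (\<lambda>\<omega>. LINT r:A|N. u r \<omega>) Y
      = (\<integral>\<omega>. (\<integral>r. indicator A r * (u r \<omega> \<bullet> Y \<omega>) \<partial>N) \<partial>M)"
    unfolding L2_inner_def
  proof (rule integral_cong_AE)
    show "(\<lambda>\<omega>. (LINT r:A|N. u r \<omega>) \<bullet> Y \<omega>) \<in> borel_measurable M"
      using L2_space_time_integral[OF u A] by (auto dest: L2_space_borel_measurable)
    show "(\<lambda>\<omega>. \<integral>r. indicator A r * (u r \<omega> \<bullet> Y \<omega>) \<partial>N) \<in> borel_measurable M"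
      by measurable
    show "AE \<omega> in M. (LINT r:A|N. u r \<omega>) \<bullet> Y \<omega> = (\<integral>r. indicator A r * (u r \<omega> \<bullet> Y \<omega>) \<partial>N)"
      using L2_process_AE_L2_path[OF u]
    proof eventually_elim
      case (elim \<omega>)
      have "integrable N (\<lambda>r. u r \<omega>)" by (rule L2_space_integrable[OF N elim])
      then have "integrable N (\<lambda>r. indicator A r *\<^sub>R u r \<omega>)"
        by (intro integrable_mult_indicator A)
      then have "(\<integral>r. (indicator A r *\<^sub>R u r \<omega>) \<bullet> Y \<omega> \<partial>N)
          = (\<integral>r. indicator A r *\<^sub>R u r \<omega> \<partial>N) \<bullet> Y \<omega>"
        by (intro integral_inner_left)
      then show ?case by (simp add: set_lebesgue_integral_def)
    qed
  qed
  also have "\<dots> = (\<integral>r. (\<integral>\<omega>. indicator A r * (u r \<omega> \<bullet> Y \<omega>) \<partial>M) \<partial>N)"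
    by (rule Fubini_integral[OF int])
  also have "\<dots> = (LINT r:A|N. L2_inner M (u r) Y)"
    by (simp add: set_lebesgue_integral_def L2_inner_def)
  finally show ?thesis .
qed

end

text \<open>The first factor of \<^term>\<open>time_space\<close>. Integrals over \<open>{t..T}\<close> are taken with respect to this
  finite measure, so that no integrability outside of \<open>{0..T}\<close> is asked for.\<close>

abbreviation time_interval :: "real \<Rightarrow> real measure" where
  "time_interval T \<equiv> restrict_space lborel {0..T}"

lemma finite_measure_time_interval: "finite_measure (time_interval T)"
  by (rule finite_measureI) (cases "0 \<le> T"; simp add: emeasure_restrict_space space_restrict_space)

lemma AE_time_interval_neq: "AE r in time_interval T. r \<noteq> s"
  by (subst AE_restrict_space_iff) (use AE_lborel_singleton[of s] in auto)

lemma Icc_in_sets_time_interval: "0 \<le> s \<Longrightarrow> {s..T} \<in> sets (time_interval T)"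
  by (auto simp: sets_restrict_space_iff)

text \<open>The square \<open>{t..T} \<times> {t..T}\<close> is cut along its diagonal, which has measure zero.\<close>

lemma double_integral_triangles:
  fixes \<phi> :: "real \<Rightarrow> real \<Rightarrow> real"
  assumes \<phi>: "integrable (time_interval T \<Otimes>\<^sub>M time_interval T) (\<lambda>(r, s). \<phi> r s)" and t: "0 \<le> t"
  defines "N \<equiv> time_interval T"
  shows "(LINT s:{t..T}|N. LINT r:{t..T}|N. \<phi> r s)
    = (LINT s:{t..T}|N. LINT r:{s..T}|N. \<phi> r s) + (LINT r:{t..T}|N. LINT s:{r..T}|N. \<phi> r s)"
proof -
  interpret N: finite_measure N unfolding N_def by (rule finite_measure_time_interval)
  interpret pair_sigma_finite N N ..
  define h1 where "h1 r s = of_bool (t \<le> s \<and> s \<le> r) * \<phi> r s" for r s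
  define h2 where "h2 r s = of_bool (t \<le> r \<and> r \<le> s) * \<phi> r s" for r s
  have [measurable]: "(\<lambda>(r, s). \<phi> r s) \<in> borel_measurable (N \<Otimes>\<^sub>M N)"
    using \<phi> unfolding N_def by (rule borel_measurable_integrable)
  have [measurable]: "(\<lambda>x. x) \<in> borel_measurable N"
    unfolding N_def by (intro measurable_restrict_space1) auto
  have fs [measurable]: "(\<lambda>x. fst x) \<in> borel_measurable (N \<Otimes>\<^sub>M N)" "(\<lambda>x. snd x) \<in> borel_measurable (N \<Otimes>\<^sub>M N)"
    by measurable
  have h1: "integrable (N \<Otimes>\<^sub>M N) (\<lambda>(r, s). h1 r s)" and h2: "integrable (N \<Otimes>\<^sub>M N) (\<lambda>(r, s). h2 r s)"
    unfolding h1_def h2_def case_prod_unfold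
    by (rule Bochner_Integration.integrable_bound[OF \<phi>[folded N_def]], measurable,
        auto simp: case_prod_unfold)+
  \<comment> \<open>The two closed triangles overlap on the diagonal \<open>r = s\<close>, a null set for every fixed \<open>s\<close>.\<close>
  have "(LINT s:{t..T}|N. LINT r:{t..T}|N. \<phi> r s) = (\<integral>s. (\<integral>r. h1 r s + h2 r s \<partial>N) \<partial>N)"
    unfolding set_lebesgue_integral_def
  proof (rule Bochner_Integration.integral_cong[OF refl], goal_cases)
    case (1 s)
    then have s: "0 \<le> s" "s \<le> T" by (auto simp: N_def space_restrict_space)
    have "indicator {t..T} s *\<^sub>R (\<integral>r. indicator {t..T} r *\<^sub>R \<phi> r s \<partial>N)
        = (\<integral>r. indicator {t..T} s * (indicator {t..T} r * \<phi> r s) \<partial>N)" by simp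
    also have "\<dots> = (\<integral>r. h1 r s + h2 r s \<partial>N)"
    proof (rule integral_cong_AE)
      show "(\<lambda>r. indicator {t..T} s * (indicator {t..T} r * \<phi> r s)) \<in> borel_measurable N"
        using 1 Icc_in_sets_time_interval[OF t, of T, folded N_def] by measurable
      show "(\<lambda>r. h1 r s + h2 r s) \<in> borel_measurable N"
        unfolding h1_def h2_def using 1 by measurable
      show "AE r in N. indicator {t..T} s * (indicator {t..T} r * \<phi> r s) = h1 r s + h2 r s"
        using AE_time_interval_neq[of s T, folded N_def] AE_space
      proof eventually_elim
        case (elim r)
        then show ?case using s by (auto simp: h1_def h2_def N_def space_restrict_space split: split_indicator)
      qed
    qed
    finally show ?case .
  qed
  also have "\<dots> = integral\<^sup>L (N \<Otimes>\<^sub>M N) (\<lambda>(r, s). h1 r s + h2 r s)"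
    using h1 h2 by (intro integral_snd) (auto simp: case_prod_unfold)
  also have "\<dots> = integral\<^sup>L (N \<Otimes>\<^sub>M N) (\<lambda>(r, s). h1 r s) + integral\<^sup>L (N \<Otimes>\<^sub>M N) (\<lambda>(r, s). h2 r s)"
    using h1 h2 by (subst Bochner_Integration.integral_add[symmetric]) (auto simp: case_prod_unfold)
  also have "\<dots> = (\<integral>s. (\<integral>r. h1 r s \<partial>N) \<partial>N) + (\<integral>r. (\<integral>s. h2 r s \<partial>N) \<partial>N)"
    using integral_snd[OF h1] integral_fst[OF h2] by simp
  also have "(\<integral>s. (\<integral>r. h1 r s \<partial>N) \<partial>N) = (LINT s:{t..T}|N. LINT r:{s..T}|N. \<phi> r s)"
    unfolding set_lebesgue_integral_def integral_scaleR_right[symmetric]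
    by (intro Bochner_Integration.integral_cong refl)
      (auto simp: h1_def N_def space_restrict_space split: split_indicator)
  also have "(\<integral>r. (\<integral>s. h2 r s \<partial>N) \<partial>N) = (LINT r:{t..T}|N. LINT s:{r..T}|N. \<phi> r s)"
    unfolding set_lebesgue_integral_def integral_scaleR_right[symmetric]
    by (intro Bochner_Integration.integral_cong refl)
      (auto simp: h2_def N_def space_restrict_space split: split_indicator)
  finally show ?thesis .
qed

section \<open>The energy identity\<close>

text \<open>Needed for Fubini on the square of times: the inner product is at most
  \<open>L2_inner M (a r) (a r) + L2_inner M (b s) (b s)\<close>, a sum of integrable functions of one time.\<close>

lemma integrable_L2_inner_double:
  fixes a b :: "'s \<Rightarrow> 'a \<Rightarrow> 'b::euclidean_space"
  assumes N: "finite_measure N" and M: "finite_measure M"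
    and a: "(\<lambda>(r, \<omega>). a r \<omega>) \<in> L2_space (N \<Otimes>\<^sub>M M)" "\<And>r. r \<in> space N \<Longrightarrow> a r \<in> L2_space M"
    and b: "(\<lambda>(r, \<omega>). b r \<omega>) \<in> L2_space (N \<Otimes>\<^sub>M M)" "\<And>r. r \<in> space N \<Longrightarrow> b r \<in> L2_space M"
  shows "integrable (N \<Otimes>\<^sub>M N) (\<lambda>(r, s). L2_inner M (a r) (b s))"
proof -
  interpret N: finite_measure N by (rule N)
  interpret M: finite_measure M by (rule M)
  interpret NN: pair_sigma_finite N N ..
  have am [measurable]: "(\<lambda>(r, \<omega>). a r \<omega>) \<in> borel_measurable (N \<Otimes>\<^sub>M M)"
    by (rule L2_space_borel_measurable[OF a(1)])
  have bm [measurable]: "(\<lambda>(r, \<omega>). b r \<omega>) \<in> borel_measurable (N \<Otimes>\<^sub>M M)"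
    by (rule L2_space_borel_measurable[OF b(1)])
  have ga: "integrable N (\<lambda>r. L2_inner M (a r) (a r))"
    by (rule integrable_L2_inner_process[OF N M a(1) a(1)])
  have gb: "integrable N (\<lambda>s. L2_inner M (b s) (b s))"
    by (rule integrable_L2_inner_process[OF N M b(1) b(1)])
  have [measurable]: "(\<lambda>r. L2_inner M (a r) (a r)) \<in> borel_measurable N"
      "(\<lambda>r. L2_inner M (b r) (b r)) \<in> borel_measurable N"
    using ga gb by auto
  have "integrable (N \<Otimes>\<^sub>M N) (\<lambda>(r, s). L2_inner M (a r) (a r))"
    using ga by (intro NN.Fubini_integrable) (auto simp: case_prod_unfold)
  moreover have "integrable (N \<Otimes>\<^sub>M N) (\<lambda>(r, s). L2_inner M (b s) (b s))"
    using gb by (intro NN.Fubini_integrable) (auto simp: case_prod_unfold)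
  ultimately have bound: "integrable (N \<Otimes>\<^sub>M N)
      (\<lambda>x. L2_inner M (a (fst x)) (a (fst x)) + L2_inner M (b (snd x)) (b (snd x)))"
    by (simp add: case_prod_unfold)
  show ?thesis
  proof (rule Bochner_Integration.integrable_bound[OF bound])
    have [measurable]: "(\<lambda>(x, \<omega>). a (fst x) \<omega>) \<in> borel_measurable ((N \<Otimes>\<^sub>M N) \<Otimes>\<^sub>M M)"
      using measurable_compose[OF _ am, of "\<lambda>(x, \<omega>). (fst x, \<omega>)" "(N \<Otimes>\<^sub>M N) \<Otimes>\<^sub>M M"]
      by (simp add: case_prod_unfold)
    have [measurable]: "(\<lambda>(x, \<omega>). b (snd x) \<omega>) \<in> borel_measurable ((N \<Otimes>\<^sub>M N) \<Otimes>\<^sub>M M)"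
      using measurable_compose[OF _ bm, of "\<lambda>(x, \<omega>). (snd x, \<omega>)" "(N \<Otimes>\<^sub>M N) \<Otimes>\<^sub>M M"]
      by (simp add: case_prod_unfold)
    have "(\<lambda>x. \<integral>\<omega>. a (fst x) \<omega> \<bullet> b (snd x) \<omega> \<partial>M) \<in> borel_measurable (N \<Otimes>\<^sub>M N)"
      by measurable
    then show "(\<lambda>(r, s). L2_inner M (a r) (b s)) \<in> borel_measurable (N \<Otimes>\<^sub>M N)"
      by (simp add: L2_inner_def case_prod_unfold)
    have "\<bar>L2_inner M (a r) (b s)\<bar> \<le> L2_inner M (a r) (a r) + L2_inner M (b s) (b s)"
      if "r \<in> space N" "s \<in> space N" for r s
    proof -
      have "\<bar>L2_inner M (a r) (b s)\<bar> \<le> L2_norm M (a r) * L2_norm M (b s)"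
        using that by (intro L2_Cauchy_Schwarz a(2) b(2))
      moreover have "0 \<le> L2_norm M (a r) * L2_norm M (b s)" by (simp add: L2_norm_nonneg)
      ultimately show ?thesis
        using sum_squares_bound[of "L2_norm M (a r)" "L2_norm M (b s)"] by (simp add: L2_norm_sq)
    qed
    then show "AE x in N \<Otimes>\<^sub>M N. norm (case x of (r, s) \<Rightarrow> L2_inner M (a r) (b s))
        \<le> norm (L2_inner M (a (fst x)) (a (fst x)) + L2_inner M (b (snd x)) (b (snd x)))"
      by (intro AE_I2) (auto simp: space_pair_measure L2_inner_self_nonneg)
  qed
qed

lemma L2_inner_add_add:
  assumes "X \<in> L2_space M" "U \<in> L2_space M" "Y \<in> L2_space M" "V \<in> L2_space M"
  shows "L2_inner M (\<lambda>\<omega>. X \<omega> + U \<omega>) (\<lambda>\<omega>. Y \<omega> + V \<omega>)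
    = L2_inner M X Y + L2_inner M X V + L2_inner M U Y + L2_inner M U V"
  using assms by (simp add: L2_inner_add_left L2_inner_add_right L2_space_add)

text \<open>Square integrability is demanded at every time as well as jointly, because inner products are
  taken at individual times, and their integrals over time are formed afterwards.\<close>

definition adapted_L2_process ::
    "'a measure \<Rightarrow> (real \<Rightarrow> 'a measure) \<Rightarrow> real \<Rightarrow> (real \<Rightarrow> 'a \<Rightarrow> 'b::euclidean_space) \<Rightarrow> bool" where
  "adapted_L2_process M \<F> T a \<longleftrightarrow>
     (\<lambda>(t, \<omega>). a t \<omega>) \<in> L2_space (time_space T M) \<and>
     (\<forall>t\<in>{0..T}. a t \<in> L2_space M \<and> a t \<in> borel_measurable (\<F> t))"

text \<open>The part of the martingale property that is used. It avoids conditional expectations and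
  is stable under $L^2$ limits. Only increments up to the horizon \<open>T\<close> occur.\<close>

definition orthogonal_future_increments ::
    "'a measure \<Rightarrow> (real \<Rightarrow> 'a measure) \<Rightarrow> real \<Rightarrow> (real \<Rightarrow> 'a \<Rightarrow> 'b::euclidean_space) \<Rightarrow> bool" where
  "orthogonal_future_increments M \<F> T K \<longleftrightarrow>
     (\<forall>t\<in>{0..T}. K t \<in> L2_space M \<and>
       (\<forall>Y. Y \<in> L2_space M \<and> Y \<in> borel_measurable (\<F> t) \<longrightarrow>
         L2_inner M (\<lambda>\<omega>. K T \<omega> - K t \<omega>) Y = 0))"

text \<open>A semimartingale $dp = - a\,dt + dK$, integrated from \<open>t\<close> to \<open>T\<close>. Forward and backward equations
  both take this form; writing it from the terminal time puts \<open>p t\<close> next to an increment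
  \<open>K T - K t\<close> which is orthogonal to it.\<close>

definition backward_decomposition ::
    "'a measure \<Rightarrow> (real \<Rightarrow> 'a measure) \<Rightarrow> real \<Rightarrow> (real \<Rightarrow> 'a \<Rightarrow> 'b::euclidean_space) \<Rightarrow>
      (real \<Rightarrow> 'a \<Rightarrow> 'b) \<Rightarrow> (real \<Rightarrow> 'a \<Rightarrow> 'b) \<Rightarrow> bool" where
  "backward_decomposition M \<F> T p a K \<longleftrightarrow>
     adapted_L2_process M \<F> T p \<and> adapted_L2_process M \<F> T a \<and>
     orthogonal_future_increments M \<F> T K \<and>
     (\<forall>t\<in>{0..T}. AE \<omega> in M.
        p t \<omega> + (K T \<omega> - K t \<omega>) = p T \<omega> + (LINT s:{t..T}|time_interval T. a s \<omega>))"

text \<open>The increment of \<open>K\<close> after \<open>t\<close> is orthogonal to \<open>Y\<close>, hence against \<open>Y\<close> the value at \<open>T\<close> differs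
  from the value at \<open>t\<close> only by the drift. This replaces a conditional expectation.\<close>

lemma backward_terminal_inner:
  fixes p :: "real \<Rightarrow> 'a \<Rightarrow> 'b::euclidean_space"
  assumes M: "finite_measure M" and p: "backward_decomposition M \<F> T p a K"
    and t: "t \<in> {0..T}" and Y: "Y \<in> L2_space M" "Y \<in> borel_measurable (\<F> t)"
  shows "L2_inner M (p T) Y = L2_inner M (p t) Y - (LINT r:{t..T}|time_interval T. L2_inner M (a r) Y)"
proof -
  let ?N = "time_interval T"
  let ?A = "\<lambda>\<omega>. LINT s:{t..T}|?N. a s \<omega>"
  have T: "T \<in> {0..T}" using t by auto
  have pL: "p t \<in> L2_space M" "p T \<in> L2_space M" and aL: "(\<lambda>(t, \<omega>). a t \<omega>) \<in> L2_space (?N \<Otimes>\<^sub>M M)"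
    and KL: "K t \<in> L2_space M" "K T \<in> L2_space M"
    and orth: "L2_inner M (\<lambda>\<omega>. K T \<omega> - K t \<omega>) Y = 0"
    and eq: "AE \<omega> in M. p t \<omega> + (K T \<omega> - K t \<omega>) = p T \<omega> + ?A \<omega>"
    using p t T Y
    by (auto simp: backward_decomposition_def adapted_L2_process_def orthogonal_future_increments_def)
  have set: "{t..T} \<in> sets ?N" using t by (intro Icc_in_sets_time_interval) auto
  have AL: "?A \<in> L2_space M"
    by (rule L2_space_time_integral[OF finite_measure_time_interval M aL set])
  have dK: "(\<lambda>\<omega>. K T \<omega> - K t \<omega>) \<in> L2_space M" by (rule L2_space_diff[OF KL(2,1)])
  have "L2_inner M (\<lambda>\<omega>. p t \<omega> + (K T \<omega> - K t \<omega>)) Y = L2_inner M (\<lambda>\<omega>. p T \<omega> + ?A \<omega>) Y"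
    using eq Y by (intro L2_inner_cong_AE L2_space_borel_measurable L2_space_add pL dK AL) auto
  then have "L2_inner M (p t) Y + 0 = L2_inner M (p T) Y + L2_inner M ?A Y"
    by (simp add: L2_inner_add_left pL dK AL Y orth)
  then show ?thesis
    using L2_inner_time_integral[OF finite_measure_time_interval M aL set Y(1)] by simp
qed

text \<open>The integrated product rule for \<open>L2_inner M (p t) (q t)\<close>; the inner product of the martingale
  increments plays the role of the bracket. Since \<open>p t\<close> and \<open>q t\<close> are orthogonal to the increments
  after \<open>t\<close>, the left hand side is the inner product of \<open>p t + (K T - K t)\<close> and \<open>q t + (J T - J t)\<close>,
  which are the sums of terminal value and drift integral. Expanding leaves three drift terms. The one
  that pairs the two drifts is a double integral over a square, and by
  \<open>backward_terminal_inner\<close> its two triangles correct the other two terms from terminal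
  values to current values.\<close>

theorem energy_identity:
  fixes p q :: "real \<Rightarrow> 'a \<Rightarrow> 'b::euclidean_space"
  assumes M: "finite_measure M"
    and p: "backward_decomposition M \<F> T p a K" and q: "backward_decomposition M \<F> T q b J"
    and t: "t \<in> {0..T}"
  shows "L2_inner M (p t) (q t) + L2_inner M (\<lambda>\<omega>. K T \<omega> - K t \<omega>) (\<lambda>\<omega>. J T \<omega> - J t \<omega>)
    = L2_inner M (p T) (q T)
      + (LINT s:{t..T}|time_interval T. L2_inner M (a s) (q s) + L2_inner M (b s) (p s))"
proof -
  let ?N = "time_interval T"
  let ?A = "\<lambda>\<omega>. LINT s:{t..T}|?N. a s \<omega>" and ?B = "\<lambda>\<omega>. LINT s:{t..T}|?N. b s \<omega>"
  let ?dK = "\<lambda>\<omega>. K T \<omega> - K t \<omega>" and ?dJ = "\<lambda>\<omega>. J T \<omega> - J t \<omega>"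
  note N = finite_measure_time_interval
  have T: "T \<in> {0..T}" using t by auto
  have pa: "adapted_L2_process M \<F> T p" "adapted_L2_process M \<F> T a"
    and qb: "adapted_L2_process M \<F> T q" "adapted_L2_process M \<F> T b"
    using p q by (auto simp: backward_decomposition_def)
  have pL: "p s \<in> L2_space M" "a s \<in> L2_space M" "q s \<in> L2_space M" "b s \<in> L2_space M"
    and ad: "p s \<in> borel_measurable (\<F> s)" "a s \<in> borel_measurable (\<F> s)"
      "q s \<in> borel_measurable (\<F> s)" "b s \<in> borel_measurable (\<F> s)" if "s \<in> {0..T}" for s
    using pa qb that by (auto simp: adapted_L2_process_def)
  have joint: "(\<lambda>(t, \<omega>). p t \<omega>) \<in> L2_space (?N \<Otimes>\<^sub>M M)" "(\<lambda>(t, \<omega>). a t \<omega>) \<in> L2_space (?N \<Otimes>\<^sub>M M)"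
    "(\<lambda>(t, \<omega>). q t \<omega>) \<in> L2_space (?N \<Otimes>\<^sub>M M)" "(\<lambda>(t, \<omega>). b t \<omega>) \<in> L2_space (?N \<Otimes>\<^sub>M M)"
    using pa qb by (auto simp: adapted_L2_process_def)
  have dL: "?dK \<in> L2_space M" "?dJ \<in> L2_space M"
    using p q t T by (auto simp: backward_decomposition_def orthogonal_future_increments_def
        intro!: L2_space_diff)
  have orth: "L2_inner M ?dK (q t) = 0" "L2_inner M ?dJ (p t) = 0"
    using p q t pL[OF t] ad[OF t]
    by (auto simp: backward_decomposition_def orthogonal_future_increments_def)
  have set: "{t..T} \<in> sets ?N" using t by (intro Icc_in_sets_time_interval) auto
  have AL: "?A \<in> L2_space M" "?B \<in> L2_space M"
    by (rule L2_space_time_integral[OF N M joint(2) set] L2_space_time_integral[OF N M joint(4) set])+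
  define \<phi> where "\<phi> r s = L2_inner M (a r) (b s)" for r s
  have \<phi>: "integrable (?N \<Otimes>\<^sub>M ?N) (\<lambda>(r, s). \<phi> r s)"
    unfolding \<phi>_def using joint(2,4) pL
    by (intro integrable_L2_inner_double[OF N M]) (auto simp: space_restrict_space)
  have "L2_inner M (\<lambda>\<omega>. p t \<omega> + ?dK \<omega>) (\<lambda>\<omega>. q t \<omega> + ?dJ \<omega>)
      = L2_inner M (\<lambda>\<omega>. p T \<omega> + ?A \<omega>) (\<lambda>\<omega>. q T \<omega> + ?B \<omega>)"
    using p q t unfolding backward_decomposition_def
    by (intro L2_inner_cong_AE L2_space_borel_measurable L2_space_add pL[OF t] pL[OF T] dL AL) auto
  then have main: "L2_inner M (p t) (q t) + L2_inner M ?dK ?dJ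
      = L2_inner M (p T) (q T) + L2_inner M ?B (p T) + L2_inner M ?A (q T) + L2_inner M ?B ?A"
    unfolding L2_inner_add_add[OF pL(1)[OF t] dL(1) pL(3)[OF t] dL(2)]
      L2_inner_add_add[OF pL(1)[OF T] AL(1) pL(3)[OF T] AL(2)]
    using orth L2_inner_commute[of M "p t" ?dJ] L2_inner_commute[of M "p T" ?B]
      L2_inner_commute[of M ?A ?B] by linarith
  \<comment> \<open>It remains to exchange the terminal values in the drift terms for the current ones, each at the
    cost of one triangle of the double integral.\<close>
  have sub: "set_integrable ?N {t..T} h" if "integrable ?N h" for h :: "real \<Rightarrow> real"
    unfolding set_integrable_def using that set by (intro integrable_mult_indicator)
  note const = L2_space_const_process[OF N M pL(1)[OF T]] L2_space_const_process[OF N M pL(3)[OF T]]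
  have int: "set_integrable ?N {t..T} (\<lambda>s. L2_inner M (b s) (p s))"
    "set_integrable ?N {t..T} (\<lambda>s. L2_inner M (a s) (q s))"
    "set_integrable ?N {t..T} (\<lambda>s. L2_inner M (b s) (p T))"
    "set_integrable ?N {t..T} (\<lambda>s. L2_inner M (a s) (q T))"
    by (intro sub integrable_L2_inner_process[OF N M] joint const)+
  have "(LINT s:{t..T}|?N. LINT r:{s..T}|?N. \<phi> r s)
      = (LINT s:{t..T}|?N. L2_inner M (b s) (p s) - L2_inner M (b s) (p T))"
  proof (rule set_lebesgue_integral_cong[OF set], safe)
    fix s assume "s \<in> {t..T}"
    then have s: "s \<in> {0..T}" using t by auto
    show "(LINT r:{s..T}|?N. \<phi> r s) = L2_inner M (b s) (p s) - L2_inner M (b s) (p T)"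
      using backward_terminal_inner[OF M p s pL(4)[OF s] ad(4)[OF s]]
      by (simp add: \<phi>_def L2_inner_commute)
  qed
  moreover have "(LINT r:{t..T}|?N. LINT s:{r..T}|?N. \<phi> r s)
      = (LINT r:{t..T}|?N. L2_inner M (a r) (q r) - L2_inner M (a r) (q T))"
  proof (rule set_lebesgue_integral_cong[OF set], safe)
    fix r assume "r \<in> {t..T}"
    then have r: "r \<in> {0..T}" using t by auto
    show "(LINT s:{r..T}|?N. \<phi> r s) = L2_inner M (a r) (q r) - L2_inner M (a r) (q T)"
      using backward_terminal_inner[OF M q r pL(2)[OF r] ad(2)[OF r]]
      by (simp add: \<phi>_def L2_inner_commute[of M _ "a r"])
  qed
  moreover have "L2_inner M ?B ?A = (LINT s:{t..T}|?N. LINT r:{t..T}|?N. \<phi> r s)"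
    unfolding L2_inner_time_integral[OF N M joint(4) set AL(1)]
  proof (rule set_lebesgue_integral_cong[OF set], safe)
    fix s assume "s \<in> {t..T}"
    then have s: "s \<in> {0..T}" using t by auto
    show "L2_inner M (b s) ?A = (LINT r:{t..T}|?N. \<phi> r s)"
      using L2_inner_time_integral[OF N M joint(2) set pL(4)[OF s]]
      by (simp add: \<phi>_def L2_inner_commute)
  qed
  moreover have "L2_inner M ?B (p T) = (LINT s:{t..T}|?N. L2_inner M (b s) (p T))"
    "L2_inner M ?A (q T) = (LINT s:{t..T}|?N. L2_inner M (a s) (q T))"
    by (rule L2_inner_time_integral[OF N M joint(4) set pL(1)[OF T]]
        L2_inner_time_integral[OF N M joint(2) set pL(3)[OF T]])+
  ultimately show ?thesis
    using main double_integral_triangles[OF \<phi>, of t] t int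
    by (simp add: set_integral_add set_integral_diff)
qed

section \<open>Increments of Brownian motion\<close>

lemma prod_Basis_vec: "(\<Prod>b\<in>(Basis :: (real^'n) set). g b) = (\<Prod>i\<in>UNIV. g (axis i 1))"
proof -
  have "(Basis :: (real^'n) set) = range (\<lambda>i. axis i 1)" by (auto simp: Basis_vec_def)
  moreover have "inj (\<lambda>i. axis i (1::real) :: real^'n)" by (auto simp: inj_def axis_eq_axis)
  ultimately show ?thesis
    using prod.reindex[of "\<lambda>i. axis i (1::real) :: real^'n" UNIV g] by (simp add: comp_def)
qed

text \<open>The density of a Brownian increment over a time span of length \<open>v\<^sup>2\<close>.\<close>

abbreviation isotropic_normal_density :: "real \<Rightarrow> real^'n \<Rightarrow> real" where
  "isotropic_normal_density v x \<equiv> \<Prod>i\<in>UNIV. normal_density 0 v (x $ i)"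

text \<open>The integrand is a product of functions of single coordinates, so Tonelli reduces the integral to
  one dimensional normal moments.\<close>

lemma nn_integral_isotropic_normal_coordinate_sq_finite:
  fixes k :: "'n::finite"
  assumes "v > 0"
  shows "(\<integral>\<^sup>+x. ennreal (isotropic_normal_density v (x :: real^'n)) * ennreal ((x $ k)\<^sup>2) \<partial>lborel) < \<infinity>"
proof -
  define h :: "real^'n \<Rightarrow> real \<Rightarrow> ennreal"
    where "h b y = ennreal (normal_density 0 v y) * (if b = axis k 1 then ennreal (y\<^sup>2) else 1)" for b y
  have "ennreal (isotropic_normal_density v x) * ennreal ((x $ k)\<^sup>2) = (\<Prod>b\<in>Basis. h b (x \<bullet> b))"
    for x :: "real^'n"
  proof -
    have "(\<Prod>b\<in>Basis. h b (x \<bullet> b))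
        = (\<Prod>i\<in>UNIV. ennreal (normal_density 0 v (x $ i)) * (if i = k then ennreal ((x $ k)\<^sup>2) else 1))"
      unfolding prod_Basis_vec by (intro prod.cong refl) (auto simp: h_def inner_axis axis_eq_axis)
    also have "\<dots> = (\<Prod>i\<in>UNIV. ennreal (normal_density 0 v (x $ i))) * ennreal ((x $ k)\<^sup>2)"
      unfolding prod.distrib by simp
    also have "(\<Prod>i\<in>UNIV. ennreal (normal_density 0 v (x $ i))) = ennreal (isotropic_normal_density v x)"
      by (rule prod_ennreal) simp
    finally show ?thesis ..
  qed
  moreover have "h b \<in> borel_measurable borel" for b
    by (cases "b = axis k 1") (simp_all add: h_def[abs_def])
  ultimately have "(\<integral>\<^sup>+x. ennreal (isotropic_normal_density v (x :: real^'n)) * ennreal ((x $ k)\<^sup>2) \<partial>lborel)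
      = (\<Prod>b\<in>Basis. \<integral>\<^sup>+y. h b y \<partial>lborel)"
    by (simp add: nn_integral_lborel_prod)
  also have "\<dots> < \<infinity>"
  proof -
    have "(\<integral>\<^sup>+y. h b y \<partial>lborel) \<noteq> \<infinity>" for b
    proof (cases "b = axis k 1")
      case True
      have "(\<integral>\<^sup>+y. h b y \<partial>lborel) = (\<integral>\<^sup>+y. ennreal (normal_density 0 v y * y\<^sup>2) \<partial>lborel)"
        using True by (simp add: h_def ennreal_mult)
      also have "\<dots> \<noteq> \<infinity>"
        using integrable_normal_moment[OF assms, of 0 2]
        by (subst nn_integral_eq_integral) auto
      finally show ?thesis .
    next
      case False
      have "(\<integral>\<^sup>+y. h b y \<partial>lborel) = (\<integral>\<^sup>+y. ennreal (normal_density 0 v y) \<partial>lborel)"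
        using False by (simp add: h_def)
      also have "\<dots> \<noteq> \<infinity>"
        using integrable_normal_density[OF assms, of 0]
        by (subst nn_integral_eq_integral) auto
      finally show ?thesis .
    qed
    then have "(\<Prod>b\<in>S. \<integral>\<^sup>+y. h b y \<partial>lborel) < \<infinity>" for S
      by (induction S rule: infinite_finite_induct) (auto simp: ennreal_mult_less_top less_top)
    then show ?thesis .
  qed
  finally show ?thesis .
qed

lemma integral_lborel_reflect:
  fixes h :: "'b::euclidean_space \<Rightarrow> real"
  assumes [measurable]: "h \<in> borel_measurable borel"
  shows "(\<integral>x. h (- x) \<partial>lborel) = (\<integral>x. h x \<partial>lborel)"
proof -
  have "(lborel :: 'b measure) = distr lborel borel (\<lambda>x. - x)"
    using lborel_affine[of "-1" "0::'b"] by (simp add: density_1)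
  then have "(\<integral>x. h x \<partial>lborel) = integral\<^sup>L (distr lborel borel (\<lambda>x. - x)) h" by simp
  also have "\<dots> = (\<integral>x. h (- x) \<partial>lborel)" by (rule integral_distr) auto
  finally show ?thesis ..
qed

lemma norm_sq_vec: "(norm (x :: real^'n))\<^sup>2 = (\<Sum>k\<in>UNIV. (x $ k)\<^sup>2)"
  by (subst power2_norm_eq_inner) (simp add: inner_vec_def power2_eq_square)

lemma borel_measurable_vec_nth [measurable]: "(\<lambda>x. (x :: real^'n) $ k) \<in> borel_measurable borel"
  by (intro borel_measurable_continuous_onI continuous_intros)

lemma isotropic_normal_L2:
  fixes D :: "'a \<Rightarrow> real^'n"
  assumes v: "v > 0"
    and D: "distributed M lborel D (\<lambda>x. ennreal (isotropic_normal_density v x))"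
  shows "D \<in> L2_space M"
proof (rule L2_spaceI)
  show Dm [measurable]: "D \<in> borel_measurable M" using distributed_measurable[OF D] by simp
  have "integrable M (\<lambda>\<omega>. (D \<omega> $ k)\<^sup>2)" for k
    unfolding integrable_iff_bounded
  proof
    have "(\<integral>\<^sup>+\<omega>. ennreal (norm ((D \<omega> $ k)\<^sup>2)) \<partial>M)
        = (\<integral>\<^sup>+x. ennreal (isotropic_normal_density v x) * ennreal ((x $ k)\<^sup>2) \<partial>lborel)"
      by (subst distributed_nn_integral[OF D]) auto
    also have "\<dots> < \<infinity>" by (rule nn_integral_isotropic_normal_coordinate_sq_finite[OF v])
    finally show "(\<integral>\<^sup>+\<omega>. ennreal (norm ((D \<omega> $ k)\<^sup>2)) \<partial>M) < \<infinity>" .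
  qed measurable
  then show "integrable M (\<lambda>\<omega>. (norm (D \<omega>))\<^sup>2)" by (simp add: norm_sq_vec)
qed

text \<open>The density is even and the coordinate is odd.\<close>

lemma isotropic_normal_mean_zero:
  fixes D :: "'a \<Rightarrow> real^'n"
  assumes D: "distributed M lborel D (\<lambda>x. ennreal (isotropic_normal_density v x))"
  shows "(\<integral>\<omega>. D \<omega> $ k \<partial>M) = 0"
proof -
  let ?h = "\<lambda>x::real^'n. isotropic_normal_density v x * x $ k"
  have nonneg: "0 \<le> isotropic_normal_density v x" for x :: "real^'n" by (simp add: prod_nonneg)
  have m: "?h \<in> borel_measurable borel" by measurable
  have "(\<integral>\<omega>. D \<omega> $ k \<partial>M) = (\<integral>x. ?h x \<partial>lborel)"
    using distributed_integral[OF D, of "\<lambda>x. x $ k"] nonneg by simp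
  moreover have "(\<integral>x. ?h (- x) \<partial>lborel) = - (\<integral>x. ?h x \<partial>lborel)"
    by (simp add: normal_density_def)
  ultimately show ?thesis using integral_lborel_reflect[OF m] by simp
qed

lemma brownian_motionD:
  assumes "brownian_motion M \<F> B"
  shows "prob_space M" "\<And>t. space (\<F> t) = space M" "\<And>t. sets (\<F> t) \<subseteq> sets M"
    "\<And>s t. s \<le> t \<Longrightarrow> sets (\<F> s) \<subseteq> sets (\<F> t)"
  using assms
  by (auto simp: brownian_motion_def filtered_prob_space_def subalgebra_def filtration_def)

lemma brownian_increment_L2:
  assumes B: "brownian_motion M \<F> B" and "0 \<le> s" "s \<le> t"
  shows "(\<lambda>\<omega>. B t \<omega> - B s \<omega>) \<in> L2_space M"
proof (cases "s = t")
  case False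
  then show ?thesis
    using assms by (intro isotropic_normal_L2[where v="sqrt (t - s)"]) (auto simp: brownian_motion_def)
qed (simp add: L2_space_zero)

lemma (in prob_space) indep_set_mono_left:
  assumes "indep_set A B" "A' \<subseteq> A" shows "indep_set A' B"
  using assms unfolding indep_sets2_eq by (meson subset_iff)

text \<open>By independence, the expectation of each product of coordinates is a product of expectations, and
  the increment is centred.\<close>

lemma brownian_increment_orthogonal:
  fixes B :: "real \<Rightarrow> 'a \<Rightarrow> real^'n"
  assumes B: "brownian_motion M \<F> B" and st: "0 \<le> s" "s \<le> t"
    and U: "U \<in> L2_space M" "U \<in> borel_measurable (\<F> s)"
  shows "L2_inner M U (\<lambda>\<omega>. B t \<omega> - B s \<omega>) = 0"
proof (cases "s = t")
  case False
  let ?D = "\<lambda>\<omega>. B t \<omega> - B s \<omega>"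
  interpret prob_space M by (rule brownian_motionD[OF B])
  have fin: "finite_measure M" by (rule finite_measure_axioms)
  have dist: "distributed M lborel ?D (\<lambda>x. ennreal (isotropic_normal_density (sqrt (t - s)) x))"
    and ind: "indep_set (sets (\<F> s)) {?D -` A \<inter> space M | A. A \<in> sets borel}"
    using B st False by (auto simp: brownian_motion_def)
  have DL: "?D \<in> L2_space M" by (rule brownian_increment_L2[OF B st])
  have Dm [measurable]: "?D \<in> borel_measurable M" by (rule L2_space_borel_measurable[OF DL])
  have Um [measurable]: "U \<in> borel_measurable M" by (rule L2_space_borel_measurable[OF U(1)])
  have "indep_set (sigma_sets (space M) {U -` A \<inter> space M | A. A \<in> sets borel})
      (sigma_sets (space M) {?D -` A \<inter> space M | A. A \<in> sets borel})"
  proof -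
    have "{U -` A \<inter> space M | A. A \<in> sets borel} \<subseteq> sets (\<F> s)"
      using measurable_sets[OF U(2)] by (auto simp: brownian_motionD(2)[OF B])
    then have "sigma_sets (space M) {U -` A \<inter> space M | A. A \<in> sets borel} \<subseteq> sets (\<F> s)"
      using sets.sigma_sets_subset[of _ "\<F> s"] by (simp add: brownian_motionD(2)[OF B])
    \<comment> \<open>The preimages of Borel sets under the increment already form a sigma algebra, so passing to the
      generated one does not enlarge the family.\<close>
    moreover have "sigma_sets (space M) {?D -` A \<inter> space M | A. A \<in> sets borel}
        = {?D -` A \<inter> space M | A. A \<in> sets borel}"
      unfolding sets_vimage_algebra[symmetric] by (rule sets_vimage_algebra2) simp
    ultimately show ?thesis
      using indep_set_mono_left[OF ind] by simp
  qed
  then have indep: "indep_var borel U borel ?D"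
    unfolding indep_var_eq using Um Dm by blast
  have coord: "(\<integral>\<omega>. U \<omega> $ k * ?D \<omega> $ k \<partial>M) = 0" "integrable M (\<lambda>\<omega>. U \<omega> $ k * ?D \<omega> $ k)" for k
  proof -
    have ik: "indep_var borel (\<lambda>\<omega>. U \<omega> $ k) borel (\<lambda>\<omega>. ?D \<omega> $ k)"
      using indep_var_compose[OF indep borel_measurable_vec_nth[of k] borel_measurable_vec_nth[of k]]
      by (simp add: comp_def)
    have iU: "integrable M (\<lambda>\<omega>. U \<omega> $ k)" "integrable M (\<lambda>\<omega>. ?D \<omega> $ k)"
      using integrable_inner_right[OF L2_space_integrable[OF fin U(1)], of "axis k 1"]
        integrable_inner_right[OF L2_space_integrable[OF fin DL], of "axis k 1"]
      by (simp_all add: inner_axis')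
    show "(\<integral>\<omega>. U \<omega> $ k * ?D \<omega> $ k \<partial>M) = 0"
      unfolding indep_var_lebesgue_integral[OF ik iU] isotropic_normal_mean_zero[OF dist] by simp
    show "integrable M (\<lambda>\<omega>. U \<omega> $ k * ?D \<omega> $ k)"
      by (rule indep_var_integrable[OF ik iU])
  qed
  show ?thesis
    unfolding L2_inner_def inner_vec_def inner_real_def
    by (subst Bochner_Integration.integral_sum) (auto simp: coord simp del: vector_minus_component)
qed (simp add: L2_inner_def)

lemma bounded_bilinear_matrix_vector_mult:
  "bounded_bilinear (\<lambda>(A :: real^'n^'m) (x :: real^'n). A *v x)"
  unfolding bilinear_conv_bounded_bilinear[symmetric] bilinear_def
  by (auto intro!: linearI simp: matrix_vector_mult_def vec_eq_iff algebra_simps sum.distrib sum_distrib_left)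

lemma bounded_bilinear_vector_matrix_mult:
  "bounded_bilinear (\<lambda>(x :: real^'m) (A :: real^'n^'m). x v* A)"
  unfolding bilinear_conv_bounded_bilinear[symmetric] bilinear_def
  by (auto intro!: linearI simp: vector_matrix_mult_def vec_eq_iff algebra_simps sum.distrib sum_distrib_left)

lemma borel_measurable_bounded_bilinear:
  fixes op :: "'b::euclidean_space \<Rightarrow> 'c::euclidean_space \<Rightarrow> 'd::euclidean_space"
  assumes op: "bounded_bilinear op" and f: "f \<in> borel_measurable M" and g: "g \<in> borel_measurable M"
  shows "(\<lambda>x. op (f x) (g x)) \<in> borel_measurable M"
  using f g
  by (rule borel_measurable_continuous_Pair)
    (intro bounded_bilinear.continuous_on[OF op] continuous_intros)

lemma L2_space_bounded_bilinear_left: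
  fixes op :: "'b::euclidean_space \<Rightarrow> 'c::euclidean_space \<Rightarrow> 'd::euclidean_space"
  assumes op: "bounded_bilinear op" and f: "f \<in> borel_measurable M" "bounded (f ` space M)"
    and X: "X \<in> L2_space M"
  shows "(\<lambda>\<omega>. op (f \<omega>) (X \<omega>)) \<in> L2_space M"
proof -
  obtain K where K: "\<And>a b. norm (op a b) \<le> norm a * norm b * K" "K \<ge> 0"
    using bounded_bilinear.nonneg_bounded[OF op] by auto
  obtain b where b: "\<And>\<omega>. \<omega> \<in> space M \<Longrightarrow> norm (f \<omega>) \<le> b"
    using f(2) by (auto simp: bounded_iff)
  show ?thesis
  proof (rule L2_space_dominated[where h="\<lambda>\<omega>. (b * K)\<^sup>2 * (norm (X \<omega>))\<^sup>2"])
    show "(\<lambda>\<omega>. op (f \<omega>) (X \<omega>)) \<in> borel_measurable M"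
      by (rule borel_measurable_bounded_bilinear[OF op f(1) L2_space_borel_measurable[OF X]])
    show "integrable M (\<lambda>\<omega>. (b * K)\<^sup>2 * (norm (X \<omega>))\<^sup>2)"
      using L2_space_integrable_norm_sq[OF X] by simp
    fix \<omega> assume "\<omega> \<in> space M"
    have "norm (op (f \<omega>) (X \<omega>)) \<le> norm (f \<omega>) * norm (X \<omega>) * K" by (rule K)
    also have "\<dots> \<le> b * norm (X \<omega>) * K"
      using b[OF \<open>\<omega> \<in> space M\<close>] K(2) by (intro mult_right_mono) auto
    finally have "(norm (op (f \<omega>) (X \<omega>)))\<^sup>2 \<le> (b * norm (X \<omega>) * K)\<^sup>2" by (rule power_mono) simp
    then show "(norm (op (f \<omega>) (X \<omega>)))\<^sup>2 \<le> (b * K)\<^sup>2 * (norm (X \<omega>))\<^sup>2"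
      by (simp add: power_mult_distrib algebra_simps)
  qed
qed

section \<open>Increments of the Ito integral\<close>

lemma brownian_filtration_measurable_mono:
  assumes B: "brownian_motion M \<F> B" and "s \<le> t" and f: "f \<in> borel_measurable (\<F> s)"
  shows "f \<in> borel_measurable (\<F> t)"
  using f brownian_motionD(4)[OF B \<open>s \<le> t\<close>]
  by (auto simp: measurable_def brownian_motionD(2)[OF B])

lemma brownian_filtration_measurable:
  assumes B: "brownian_motion M \<F> B" and f: "f \<in> borel_measurable (\<F> s)"
  shows "f \<in> borel_measurable M"
  using f brownian_motionD(3)[OF B]
  by (auto simp: measurable_def brownian_motionD(2)[OF B])

lemma simple_process_partition_mono:
  assumes "simple_process \<F> T n p \<xi>" and "i \<le> j" "j \<le> n"
  shows "p i \<le> p j"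
  using assms(2,3)
proof (induction j rule: dec_induct)
  case (step m)
  have "p m < p (Suc m)" using assms(1) step by (simp add: simple_process_def)
  moreover have "p i \<le> p m" using step by simp
  ultimately show ?case by linarith
qed simp

lemma matrix_brownian_increment_L2:
  fixes B :: "real \<Rightarrow> 'a \<Rightarrow> real^'n" and \<xi> :: "'a \<Rightarrow> real^'n^'n"
  assumes B: "brownian_motion M \<F> B" and st: "0 \<le> s" "s \<le> t"
    and \<xi>: "\<xi> \<in> borel_measurable M" "bounded (\<xi> ` space M)"
  shows "(\<lambda>\<omega>. \<xi> \<omega> *v (B t \<omega> - B s \<omega>)) \<in> L2_space M"
  by (rule L2_space_bounded_bilinear_left[OF bounded_bilinear_matrix_vector_mult \<xi>
        brownian_increment_L2[OF B st]])

text \<open>The matrix is moved to the other side of the inner product, where it acts on \<open>Y\<close>; the result is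
  still square integrable and measurable at time \<open>s\<close>.\<close>

lemma matrix_brownian_increment_orthogonal:
  fixes B :: "real \<Rightarrow> 'a \<Rightarrow> real^'n" and \<xi> :: "'a \<Rightarrow> real^'n^'n"
  assumes B: "brownian_motion M \<F> B" and st: "0 \<le> s" "s \<le> t"
    and \<xi>: "\<xi> \<in> borel_measurable (\<F> s)" "bounded (\<xi> ` space M)"
    and Y: "Y \<in> L2_space M" "Y \<in> borel_measurable (\<F> s)"
  shows "L2_inner M (\<lambda>\<omega>. \<xi> \<omega> *v (B t \<omega> - B s \<omega>)) Y = 0"
proof -
  have "L2_inner M (\<lambda>\<omega>. \<xi> \<omega> *v (B t \<omega> - B s \<omega>)) Y
      = L2_inner M (\<lambda>\<omega>. Y \<omega> v* \<xi> \<omega>) (\<lambda>\<omega>. B t \<omega> - B s \<omega>)"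
    unfolding L2_inner_def by (simp add: dot_lmul_matrix inner_commute)
  also have "\<dots> = 0"
  proof (rule brownian_increment_orthogonal[OF B st])
    show "(\<lambda>\<omega>. Y \<omega> v* \<xi> \<omega>) \<in> L2_space M"
      by (rule L2_space_bounded_bilinear_left[OF
            bounded_bilinear.flip[OF bounded_bilinear_vector_matrix_mult]
            brownian_filtration_measurable[OF B \<xi>(1)] \<xi>(2) Y(1)])
    show "(\<lambda>\<omega>. Y \<omega> v* \<xi> \<omega>) \<in> borel_measurable (\<F> s)"
      by (rule borel_measurable_bounded_bilinear[OF bounded_bilinear_vector_matrix_mult Y(2) \<xi>(1)])
  qed
  finally show ?thesis .
qed

lemma simple_integral_L2:
  assumes B: "brownian_motion M \<F> B" and \<xi>: "simple_process \<F> T n p \<xi>" and t: "0 \<le> t"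
  shows "simple_integral B n p \<xi> t \<in> L2_space M"
proof -
  have "(\<lambda>\<omega>. \<xi> i \<omega> *v (B (min t (p (Suc i))) \<omega> - B (min t (p i)) \<omega>)) \<in> L2_space M"
    if i: "i \<in> {..<n}" for i
  proof (rule matrix_brownian_increment_L2[OF B])
    show "0 \<le> min t (p i)"
      using simple_process_partition_mono[OF \<xi>, of 0 i] \<xi> i t by (auto simp: simple_process_def)
    show "min t (p i) \<le> min t (p (Suc i))"
      using \<xi> i by (force simp: simple_process_def)
    show "\<xi> i \<in> borel_measurable M"
      using \<xi> i by (intro brownian_filtration_measurable[OF B, of _ "p i"]) (auto simp: simple_process_def)
    show "bounded (\<xi> i ` space M)"
      using \<xi> i by (auto simp: simple_process_def brownian_motionD(2)[OF B])
  qed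
  from L2_space_sum[OF this, of "{..<n}"] show ?thesis
    by (simp add: simple_integral_def[abs_def])
qed

text \<open>The increment after \<open>t\<close> is again a simple integral, for the partition cut at \<open>t\<close>: intervals before
  \<open>t\<close> contribute nothing, and the interval that contains \<open>t\<close> is shortened to start there.\<close>

lemma simple_integral_increment:
  assumes \<xi>: "simple_process \<F> T n p \<xi>"
  shows "simple_integral B n p \<xi> T \<omega> - simple_integral B n p \<xi> t \<omega>
    = (\<Sum>i<n. \<xi> i \<omega> *v (B (max (min t T) (p (Suc i))) \<omega> - B (max (min t T) (p i)) \<omega>))"
  unfolding simple_integral_def sum_subtractf[symmetric]
proof (rule sum.cong[OF refl])
  fix i assume i: "i \<in> {..<n}"
  have "p i < p (Suc i)" "p i \<le> p n" "p (Suc i) \<le> p n" "p n = T"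
    using \<xi> i simple_process_partition_mono[OF \<xi>, of _ n] by (auto simp: simple_process_def)
  then consider "p (Suc i) \<le> t" "p (Suc i) \<le> T" "p i \<le> t" "p i \<le> T" "p i < p (Suc i)"
    | "p i \<le> t" "t \<le> p (Suc i)" "p i < p (Suc i)" "p (Suc i) \<le> T"
    | "t \<le> p i" "p i < p (Suc i)" "p (Suc i) \<le> T" by linarith
  then show "\<xi> i \<omega> *v (B (min T (p (Suc i))) \<omega> - B (min T (p i)) \<omega>)
      - \<xi> i \<omega> *v (B (min t (p (Suc i))) \<omega> - B (min t (p i)) \<omega>)
      = \<xi> i \<omega> *v (B (max (min t T) (p (Suc i))) \<omega> - B (max (min t T) (p i)) \<omega>)"
    unfolding matrix_vector_mult_diff_distrib[symmetric]
    by cases (auto simp: min_def max_def)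
qed

text \<open>On each interval of the cut partition, \<open>Y\<close> and the coefficient are measurable at the left end
  point, because it is at least \<open>t\<close> and at least the original left end point.\<close>

lemma simple_integral_orthogonal:
  fixes B :: "real \<Rightarrow> 'a \<Rightarrow> real^'n"
  assumes B: "brownian_motion M \<F> B" and \<xi>: "simple_process \<F> T n p \<xi>" and t: "t \<in> {0..T}"
    and Y: "Y \<in> L2_space M" "Y \<in> borel_measurable (\<F> t)"
  shows "L2_inner M (\<lambda>\<omega>. simple_integral B n p \<xi> T \<omega> - simple_integral B n p \<xi> t \<omega>) Y = 0"
proof -
  let ?d = "\<lambda>i \<omega>. \<xi> i \<omega> *v (B (max t (p (Suc i))) \<omega> - B (max t (p i)) \<omega>)"
  have i: "0 \<le> max t (p i)" "max t (p i) \<le> max t (p (Suc i))"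
    "\<xi> i \<in> borel_measurable (\<F> (max t (p i)))" "bounded (\<xi> i ` space M)"
    "Y \<in> borel_measurable (\<F> (max t (p i)))" if "i < n" for i
  proof -
    have "p i < p (Suc i)" "\<xi> i \<in> borel_measurable (\<F> (p i))" "bounded (\<xi> i ` space M)"
      using \<xi> that by (auto simp: simple_process_def brownian_motionD(2)[OF B])
    then show "0 \<le> max t (p i)" "max t (p i) \<le> max t (p (Suc i))" "bounded (\<xi> i ` space M)"
      "\<xi> i \<in> borel_measurable (\<F> (max t (p i)))"
      using t brownian_filtration_measurable_mono[OF B, of "p i" "max t (p i)"] by auto
    show "Y \<in> borel_measurable (\<F> (max t (p i)))"
      by (rule brownian_filtration_measurable_mono[OF B _ Y(2)]) simp
  qed
  have d: "?d i \<in> L2_space M" "L2_inner M (?d i) Y = 0" if "i < n" for i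
    using matrix_brownian_increment_L2[OF B i(1,2)[OF that]
        brownian_filtration_measurable[OF B i(3)[OF that]] i(4)[OF that]]
      matrix_brownian_increment_orthogonal[OF B i(1-4)[OF that] Y(1) i(5)[OF that]] by auto
  have "L2_inner M (\<lambda>\<omega>. simple_integral B n p \<xi> T \<omega> - simple_integral B n p \<xi> t \<omega>) Y
      = (\<integral>\<omega>. (\<Sum>i<n. ?d i \<omega> \<bullet> Y \<omega>) \<partial>M)"
    using t by (simp add: L2_inner_def simple_integral_increment[OF \<xi>] inner_sum_left)
  also have "\<dots> = (\<Sum>i<n. L2_inner M (?d i) Y)"
    unfolding L2_inner_def
    by (rule Bochner_Integration.integral_sum) (use d(1) Y(1) in \<open>auto intro: integrable_inner_L2\<close>)
  also have "\<dots> = 0" using d(2) by simp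
  finally show ?thesis .
qed

text \<open>Orthogonality holds for the approximating simple integrals and survives their $L^2$ limit
  by Cauchy-Schwarz. That the simple integrals are square integrable matters here: otherwise the
  convergence of \<open>L2_norm\<close>, a Bochner integral, would carry no information.\<close>

theorem ito_integral_orthogonal_future_increments:
  fixes B :: "real \<Rightarrow> 'a \<Rightarrow> real^'n"
  assumes B: "brownian_motion M \<F> B" and I: "is_ito_integral M \<F> B T Z I"
  shows "orthogonal_future_increments M \<F> T I"
  unfolding orthogonal_future_increments_def
proof (intro ballI conjI allI impI)
  fix t assume t: "t \<in> {0..T}"
  then have T: "T \<in> {0..T}" by auto
  have IL: "I t \<in> L2_space M" if "t \<in> {0..T}" for t
    using I that by (auto simp: is_ito_integral_def)
  show "I t \<in> L2_space M" by (rule IL[OF t])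
  fix Y :: "'a \<Rightarrow> real^'n" assume "Y \<in> L2_space M \<and> Y \<in> borel_measurable (\<F> t)"
  then have Y: "Y \<in> L2_space M" "Y \<in> borel_measurable (\<F> t)" by auto
  obtain n p \<xi> where \<xi>: "\<And>k. simple_process \<F> T (n k) (p k) (\<xi> k)"
    and lim: "\<And>t. t \<in> {0..T} \<Longrightarrow>
      (\<lambda>k. L2_norm M (\<lambda>\<omega>. simple_integral B (n k) (p k) (\<xi> k) t \<omega> - I t \<omega>)) \<longlonglongrightarrow> 0"
    using I unfolding is_ito_integral_def by blast
  define S where "S k = simple_integral B (n k) (p k) (\<xi> k)" for k
  have SL: "S k t \<in> L2_space M" if "t \<in> {0..T}" for k t
    unfolding S_def using that by (intro simple_integral_L2[OF B \<xi>]) auto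
  let ?e = "\<lambda>k t. L2_norm M (\<lambda>\<omega>. S k t \<omega> - I t \<omega>)"
  have "\<bar>L2_inner M (\<lambda>\<omega>. I T \<omega> - I t \<omega>) Y\<bar> \<le> (?e k T + ?e k t) * L2_norm M Y" for k
  proof -
    have err: "(\<lambda>\<omega>. S k s \<omega> - I s \<omega>) \<in> L2_space M" if "s \<in> {0..T}" for s
      by (rule L2_space_diff[OF SL[OF that] IL[OF that]])
    have "0 = L2_inner M (\<lambda>\<omega>. S k T \<omega> - S k t \<omega>) Y"
      using simple_integral_orthogonal[OF B \<xi> t Y] by (simp add: S_def)
    then have "L2_inner M (\<lambda>\<omega>. I T \<omega> - I t \<omega>) Y
        = L2_inner M (\<lambda>\<omega>. S k t \<omega> - I t \<omega>) Y - L2_inner M (\<lambda>\<omega>. S k T \<omega> - I T \<omega>) Y"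
      using L2_inner_diff_left[OF SL[OF T] SL[OF t] Y(1)] L2_inner_diff_left[OF IL[OF T] IL[OF t] Y(1)]
        L2_inner_diff_left[OF SL[OF T] IL[OF T] Y(1)] L2_inner_diff_left[OF SL[OF t] IL[OF t] Y(1)]
      by simp
    then show ?thesis
      using L2_Cauchy_Schwarz[OF err[OF T] Y(1)] L2_Cauchy_Schwarz[OF err[OF t] Y(1)]
      by (simp add: distrib_right)
  qed
  moreover have "(\<lambda>k. (?e k T + ?e k t) * L2_norm M Y) \<longlonglongrightarrow> (0 + 0) * L2_norm M Y"
    using lim[OF T] lim[OF t] unfolding S_def by (intro tendsto_intros)
  ultimately have "\<bar>L2_inner M (\<lambda>\<omega>. I T \<omega> - I t \<omega>) Y\<bar> \<le> 0"
    by (intro LIMSEQ_le_const[of "\<lambda>k. (?e k T + ?e k t) * L2_norm M Y"]) auto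
  then show "L2_inner M (\<lambda>\<omega>. I T \<omega> - I t \<omega>) Y = 0" by simp
qed

lemma orthogonal_future_increments_diff:
  fixes K J :: "real \<Rightarrow> 'a \<Rightarrow> 'b::euclidean_space"
  assumes "orthogonal_future_increments M \<F> T K" "orthogonal_future_increments M \<F> T J"
  shows "orthogonal_future_increments M \<F> T (\<lambda>t \<omega>. K t \<omega> - J t \<omega>)"
  unfolding orthogonal_future_increments_def
proof (intro ballI conjI allI impI)
  fix t assume t: "t \<in> {0..T}"
  then have T: "T \<in> {0..T}" by auto
  have L: "K t \<in> L2_space M" "J t \<in> L2_space M" if "t \<in> {0..T}" for t
    using assms that by (auto simp: orthogonal_future_increments_def)
  show "(\<lambda>\<omega>. K t \<omega> - J t \<omega>) \<in> L2_space M" by (rule L2_space_diff[OF L[OF t]])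
  fix Y :: "'a \<Rightarrow> 'b" assume Y: "Y \<in> L2_space M \<and> Y \<in> borel_measurable (\<F> t)"
  have "L2_inner M (\<lambda>\<omega>. (K T \<omega> - J T \<omega>) - (K t \<omega> - J t \<omega>)) Y
      = L2_inner M (\<lambda>\<omega>. (K T \<omega> - K t \<omega>) - (J T \<omega> - J t \<omega>)) Y"
    by (simp add: algebra_simps)
  also have "\<dots> = L2_inner M (\<lambda>\<omega>. K T \<omega> - K t \<omega>) Y - L2_inner M (\<lambda>\<omega>. J T \<omega> - J t \<omega>) Y"
    using Y by (intro L2_inner_diff_left L2_space_diff L[OF t] L[OF T]) auto
  also have "\<dots> = 0"
    using assms t Y by (auto simp: orthogonal_future_increments_def)
  finally show "L2_inner M (\<lambda>\<omega>. (K T \<omega> - J T \<omega>) - (K t \<omega> - J t \<omega>)) Y = 0" .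
qed

section \<open>A backward Gronwall inequality\<close>

lemma set_integral_time_interval:
  fixes u :: "real \<Rightarrow> 'b::euclidean_space"
  assumes "0 \<le> a" "b \<le> T"
  shows "(LINT s:{a..b}|time_interval T. u s) = (LINT s:{a..b}|lborel. u s)"
proof -
  have "(LINT s:{a..b}|time_interval T. u s) = (\<integral>s. indicator {0..T} s *\<^sub>R indicator {a..b} s *\<^sub>R u s \<partial>lborel)"
    unfolding set_lebesgue_integral_def by (rule integral_restrict_space) simp
  also have "\<dots> = (LINT s:{a..b}|lborel. u s)"
    unfolding set_lebesgue_integral_def using assms
    by (intro Bochner_Integration.integral_cong refl) (auto split: split_indicator)
  finally show ?thesis .
qed

lemma set_integral_singleton_lborel:
  fixes u :: "real \<Rightarrow> 'b::euclidean_space"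
  shows "(LINT s:{t}|lborel. u s) = 0"
proof -
  have "AE s in lborel. indicator {t} s *\<^sub>R u s = 0"
    using AE_lborel_singleton[of t] by eventually_elim (auto split: split_indicator)
  then show ?thesis unfolding set_lebesgue_integral_def by (rule integral_eq_zero_AE)
qed

lemma set_integral_time_interval_split:
  fixes u :: "real \<Rightarrow> 'b::euclidean_space"
  assumes u: "integrable (time_interval T) u" and t: "t \<in> {0..T}"
  shows "(LINT s:{0..T}|time_interval T. u s)
    = (LINT s:{0..t}|time_interval T. u s) + (LINT s:{t..T}|time_interval T. u s)"
proof -
  let ?N = "time_interval T"
  have [measurable]: "u \<in> borel_measurable ?N" using u by auto
  have i: "integrable ?N (\<lambda>s. indicator {a..b} s *\<^sub>R u s)" if "{a..b} \<subseteq> {0..T}" for a b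
    using u that by (intro integrable_mult_indicator) (auto simp: sets_restrict_space_iff)
  have "(\<integral>s. indicator {0..T} s *\<^sub>R u s \<partial>?N)
      = (\<integral>s. indicator {0..t} s *\<^sub>R u s + indicator {t..T} s *\<^sub>R u s \<partial>?N)"
  proof (rule integral_cong_AE)
    show "AE s in ?N. indicator {0..T} s *\<^sub>R u s = indicator {0..t} s *\<^sub>R u s + indicator {t..T} s *\<^sub>R u s"
      using AE_time_interval_neq[of t T]
      by eventually_elim (use t in \<open>auto split: split_indicator\<close>)
    show "(\<lambda>s. indicator {0..T} s *\<^sub>R u s) \<in> borel_measurable ?N"
      by (rule borel_measurable_integrable[OF i]) auto
    show "(\<lambda>s. indicator {0..t} s *\<^sub>R u s + indicator {t..T} s *\<^sub>R u s) \<in> borel_measurable ?N"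
      using t by (intro borel_measurable_integrable Bochner_Integration.integrable_add i) auto
  qed
  also have "\<dots> = (\<integral>s. indicator {0..t} s *\<^sub>R u s \<partial>?N) + (\<integral>s. indicator {t..T} s *\<^sub>R u s \<partial>?N)"
    using t by (intro Bochner_Integration.integral_add i) auto
  finally show ?thesis by (simp add: set_lebesgue_integral_def)
qed

text \<open>The function \<open>h\<close> is merely integrable. The usual argument is therefore applied to its continuous
  majorant \<open>R\<close>, the right hand side of the assumption, which satisfies the same inequality: with
  \<open>Q s = A + K * integral {s..T} R\<close> one has \<open>h \<le> R \<le> Q\<close> and \<open>Q' = - K * R \<ge> - K * Q\<close>, so that
  \<open>exp (K * s) * Q s\<close> is nondecreasing.\<close>

lemma backward_gronwall:
  fixes h :: "real \<Rightarrow> real"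
  assumes h: "integrable (time_interval T) h" and K: "0 \<le> K"
    and le: "\<And>t. t \<in> {0..T} \<Longrightarrow> h t \<le> A + K * (LINT s:{t..T}|time_interval T. h s)"
    and t: "t \<in> {0..T}"
  shows "h t \<le> A * exp (K * (T - t))"
proof -
  have hl: "set_integrable lborel {0..T} h"
    using h by (simp add: integrable_restrict_space set_integrable_def)
  have hs: "set_integrable lborel {s..T} h" if "s \<in> {0..T}" for s
    using that by (intro set_integrable_subset[OF hl]) auto
  have hi: "h integrable_on {0..T}"
    by (rule set_borel_integral_eq_integral(1)[OF hl])
  have eq: "(LINT s:{s..T}|time_interval T. h s) = integral {s..T} h" if "s \<in> {0..T}" for s
    using set_integral_time_interval[of s T T h] set_borel_integral_eq_integral(2)[OF hs[OF that]] that
    by simp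
  define R where "R s = A + K * integral {s..T} h" for s
  define Q where "Q s = A + K * integral {s..T} R" for s
  have Rc: "continuous_on {0..T} R"
    unfolding R_def by (intro continuous_intros indefinite_integral_continuous_1' hi)
  have hR: "h s \<le> R s" if "s \<in> {0..T}" for s
    using le[OF that] eq[OF that] by (simp add: R_def)
  have RQ: "R s \<le> Q s" if s: "s \<in> {0..T}" for s
  proof -
    have "integral {s..T} h \<le> integral {s..T} R"
      using s hR by (intro integral_le integrable_continuous_real continuous_on_subset[OF Rc]
          integrable_on_subinterval[OF hi]) auto
    then show ?thesis using K by (simp add: R_def Q_def mult_left_mono)
  qed
  have Qd: "(Q has_real_derivative - K * R s) (at s within {0..T})" if "s \<in> {0..T}" for s
  proof -
    have "((\<lambda>s. integral {s..T} R) has_real_derivative - R s) (at s within {0..T})"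
      using integral_has_vector_derivative'[OF Rc that]
      by (simp add: has_real_derivative_iff_has_vector_derivative)
    then show ?thesis unfolding Q_def
      by (auto intro!: derivative_eq_intros)
  qed
  let ?e = "\<lambda>s. exp (K * s) * Q s"
  have ed: "(?e has_real_derivative exp (K * s) * K * (Q s - R s)) (at s within {0..T})"
    if "s \<in> {0..T}" for s
  proof -
    have "((\<lambda>s. exp (K * s)) has_real_derivative K * exp (K * s)) (at s within {0..T})"
      by (auto intro!: derivative_eq_intros)
    from DERIV_mult[OF this Qd[OF that]] show ?thesis
      by (rule DERIV_cong) (simp add: algebra_simps)
  qed
  have "?e t \<le> ?e T"
  proof (rule DERIV_nonneg_imp_increasing_open[where f = ?e])
    show "t \<le> T" using t by simp
    show "continuous_on {t..T} ?e"
      by (rule continuous_on_subset[OF DERIV_continuous_on[OF ed]]) (use t in auto)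
    fix s assume s: "t < s" "s < T"
    then have sT: "s \<in> {0..T}" and "at s within {0..T} = at s"
      using t by (auto intro!: at_within_interior)
    then have "(?e has_real_derivative exp (K * s) * K * (Q s - R s)) (at s)"
      using ed[of s] by simp
    moreover have "0 \<le> exp (K * s) * K * (Q s - R s)"
      using K RQ[OF sT] by simp
    ultimately show "\<exists>y. (?e has_real_derivative y) (at s) \<and> 0 \<le> y" by blast
  qed
  then have "exp (K * t) * Q t \<le> exp (K * T) * A" by (simp add: Q_def)
  then have "Q t \<le> A * (exp (K * T) / exp (K * t))"
    by (simp add: field_simps)
  then show ?thesis
    using hR[OF t] RQ[OF t] by (simp add: exp_diff[symmetric] algebra_simps)
qed

section \<open>Lifted coefficients along square integrable processes\<close>

lemma law_in_P2:
  assumes M: "prob_space M" and X: "X \<in> L2_space M"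
  shows "law M X \<in> P2" and "E2 (law M X) = L2_inner M X X"
proof -
  have m [measurable]: "X \<in> borel_measurable M" by (rule L2_space_borel_measurable[OF X])
  show "law M X \<in> P2"
    using L2_space_integrable_norm_sq[OF X] prob_space.prob_space_distr[OF M m]
    by (simp add: P2_def law_def integrable_distr_eq)
  show "E2 (law M X) = L2_inner M X X"
    by (simp add: E2_def law_def integral_distr L2_inner_def power2_norm_eq_inner)
qed

text \<open>The diagonal coupling has cost zero. The inequality is enough to apply the continuity
  assumptions with both measures equal.\<close>

lemma W2_self_le:
  assumes "\<mu> \<in> P2" shows "W2 \<mu> \<mu> \<le> 0"
proof -
  let ?\<pi> = "distr \<mu> (borel \<Otimes>\<^sub>M borel) (\<lambda>x. (x, x))"
  let ?c = "\<lambda>\<pi>. \<integral>z. (dist (fst z) (snd z))\<^sup>2 \<partial>\<pi>"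
  have \<mu>: "prob_space \<mu>" "sets \<mu> = sets borel" using assms by (auto simp: P2_def)
  have [measurable]: "(\<lambda>x. (x, x)) \<in> measurable \<mu> (borel \<Otimes>\<^sub>M borel)"
    using \<mu>(2) by (simp cong: measurable_cong_sets)
  have id: "distr \<mu> borel (\<lambda>x. x) = \<mu>" using \<mu>(2) by (rule distr_id2[OF _, OF sym])
  have "?\<pi> \<in> couplings \<mu> \<mu>"
    unfolding couplings_def using \<mu>
    by (auto simp: distr_distr comp_def id intro!: prob_space.prob_space_distr)
  then have "(INF \<pi>\<in>couplings \<mu> \<mu>. ?c \<pi>) \<le> ?c ?\<pi>"
    by (intro cINF_lower bdd_belowI[of _ 0]) auto
  also have "?c ?\<pi> = 0" by (subst integral_distr) auto
  finally show ?thesis by (simp add: W2_def)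
qed

lemma continuous_P2_2_continuous_on:
  assumes F: "continuous_P2_2 F" and \<mu>: "\<mu> \<in> P2"
  shows "continuous_on UNIV (\<lambda>z. F (fst z) \<mu> (snd z))"
  unfolding continuous_on_iff
proof safe
  fix x u and e :: real assume "e > 0"
  then obtain d where d: "d > 0" "\<And>y v \<nu>. \<nu> \<in> P2 \<Longrightarrow> dist x y < d \<Longrightarrow> W2 \<mu> \<nu> < d \<Longrightarrow> dist u v < d
      \<Longrightarrow> dist (F x \<mu> u) (F y \<nu> v) < e"
    using F \<mu> unfolding continuous_P2_2_def by meson
  show "\<exists>d>0. \<forall>z'\<in>UNIV. dist z' (x, u) < d \<longrightarrow>
      dist (F (fst z') \<mu> (snd z')) (F (fst (x, u)) \<mu> (snd (x, u))) < e"
  proof (intro exI[of _ d] conjI ballI impI d(1))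
    fix z' assume "dist z' (x, u) < d"
    then have "dist x (fst z') < d" "dist u (snd z') < d"
      using dist_fst_le[of z' "(x, u)"] dist_snd_le[of z' "(x, u)"] by (auto simp: dist_commute)
    then show "dist (F (fst z') \<mu> (snd z')) (F (fst (x, u)) \<mu> (snd (x, u))) < e"
      using d(2)[OF \<mu>, of "fst z'" "snd z'"] W2_self_le[OF \<mu>] d(1)
      by (simp add: dist_commute[of "F (fst z') \<mu> (snd z')"])
  qed
qed

lemma continuous_P2_continuous_on:
  assumes F: "continuous_P2 F" and \<mu>: "\<mu> \<in> P2"
  shows "continuous_on UNIV (\<lambda>x. F x \<mu>)"
  unfolding continuous_on_iff
proof safe
  fix x and e :: real assume "e > 0"
  then obtain d where d: "d > 0" "\<And>y \<nu>. \<nu> \<in> P2 \<Longrightarrow> dist x y < d \<Longrightarrow> W2 \<mu> \<nu> < d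
      \<Longrightarrow> dist (F x \<mu>) (F y \<nu>) < e"
    using F \<mu> unfolding continuous_P2_def by meson
  then show "\<exists>d>0. \<forall>y\<in>UNIV. dist y x < d \<longrightarrow> dist (F y \<mu>) (F x \<mu>) < e"
    using d(2)[OF \<mu>] W2_self_le[OF \<mu>] by (intro exI[of _ d]) (auto simp: dist_commute)
qed

text \<open>The law of \<open>X\<close> is a fixed measure here, so the lift is a continuous function of the pair
  \<open>(X, U)\<close> and inherits measurability with respect to any sigma algebra. With that of a
  filtration this gives adaptedness of the coefficients.\<close>

lemma lift_borel_measurable:
  assumes M: "prob_space M" and F: "continuous_P2_2 F" and X: "X \<in> L2_space M"
    and m: "X \<in> borel_measurable \<G>" "U \<in> borel_measurable \<G>"
  shows "lift M F X U \<in> borel_measurable \<G>"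
  unfolding lift_def
  by (rule borel_measurable_continuous_Pair[OF m continuous_P2_2_continuous_on[OF F law_in_P2(1)[OF M X]]])

lemma lift0_borel_measurable:
  assumes M: "prob_space M" and F: "continuous_P2 F" and X: "X \<in> L2_space M"
  shows "lift0 M F X \<in> borel_measurable M"
  unfolding lift0_def
  using borel_measurable_continuous_onI[OF continuous_P2_continuous_on[OF F law_in_P2(1)[OF M X]]]
    L2_space_borel_measurable[OF X] by measurable

text \<open>The second moment of the law is \<open>L2_inner M X X\<close>, so linear growth of \<open>F\<close> becomes linear growth
  in $L^2$; the factor 4 counts the summands under the square.\<close>

lemma norm_lift_sq_le:
  assumes M: "prob_space M" and X: "X \<in> L2_space M"
    and growth: "\<And>x \<mu> u. \<mu> \<in> P2 \<Longrightarrow> norm (F x \<mu> u) \<le> C * (1 + norm x + norm u + sqrt (E2 \<mu>))"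
  shows "(norm (lift M F X U \<omega>))\<^sup>2
    \<le> 4 * C\<^sup>2 * (1 + (norm (X \<omega>))\<^sup>2 + (norm (U \<omega>))\<^sup>2 + L2_inner M X X)"
proof -
  have four: "(a + b + c + d)\<^sup>2 \<le> 4 * (a\<^sup>2 + b\<^sup>2 + c\<^sup>2 + d\<^sup>2)" for a b c d :: real
    using sum_squares_bound[of a b] sum_squares_bound[of a c] sum_squares_bound[of a d]
      sum_squares_bound[of b c] sum_squares_bound[of b d] sum_squares_bound[of c d]
    by (simp add: power2_eq_square algebra_simps)
  let ?s = "1 + norm (X \<omega>) + norm (U \<omega>) + L2_norm M X"
  have "norm (lift M F X U \<omega>) \<le> C * ?s"
    using growth[OF law_in_P2(1)[OF M X]] by (simp add: lift_def law_in_P2(2)[OF M X] L2_norm_def)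
  then have "(norm (lift M F X U \<omega>))\<^sup>2 \<le> (C * ?s)\<^sup>2" by (rule power_mono) simp
  also have "\<dots> = C\<^sup>2 * ?s\<^sup>2" by (rule power_mult_distrib)
  also have "\<dots> \<le> C\<^sup>2 * (4 * (1\<^sup>2 + (norm (X \<omega>))\<^sup>2 + (norm (U \<omega>))\<^sup>2 + (L2_norm M X)\<^sup>2))"
    by (intro mult_left_mono four) simp
  finally show ?thesis by (simp add: L2_norm_sq algebra_simps)
qed

lemma adapted_L2_process_lift:
  assumes M: "prob_space M" and \<F>: "\<And>t. t \<in> {0..T} \<Longrightarrow> sets (\<F> t) \<subseteq> sets M \<and> space (\<F> t) = space M"
    and F: "continuous_P2_2 F"
    and growth: "\<And>x \<mu> u. \<mu> \<in> P2 \<Longrightarrow> norm (F x \<mu> u) \<le> C * (1 + norm x + norm u + sqrt (E2 \<mu>))"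
    and X: "adapted_L2_process M \<F> T X" and W: "adapted_L2_process M \<F> T W"
    and joint: "(\<lambda>(s, \<omega>). lift M F (X s) (W s) \<omega>) \<in> borel_measurable (time_space T M)"
  shows "adapted_L2_process M \<F> T (\<lambda>s. lift M F (X s) (W s))"
  unfolding adapted_L2_process_def
proof (intro conjI ballI)
  interpret prob_space M by (rule M)
  interpret N: finite_measure "time_interval T" by (rule finite_measure_time_interval)
  interpret pair_sigma_finite "time_interval T" M ..
  have fin: "finite_measure M" by (rule finite_measure_axioms)
  have XL: "X s \<in> L2_space M" "W s \<in> L2_space M" if "s \<in> {0..T}" for s
    using X W that by (auto simp: adapted_L2_process_def)
  have Xj: "(\<lambda>(t, \<omega>). X t \<omega>) \<in> L2_space (time_space T M)" "(\<lambda>(t, \<omega>). W t \<omega>) \<in> L2_space (time_space T M)"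
    using X W by (auto simp: adapted_L2_process_def)
  have i: "integrable (time_interval T) (\<lambda>s. L2_inner M (X s) (X s))"
    by (rule integrable_L2_inner_process[OF finite_measure_time_interval fin Xj(1) Xj(1)])
  have [measurable]: "(\<lambda>s. L2_inner M (X s) (X s)) \<in> borel_measurable (time_interval T)"
    using i by auto
  have "integrable (time_space T M) (\<lambda>(s, \<omega>). L2_inner M (X s) (X s))"
    using i by (intro Fubini_integrable) (auto simp: case_prod_unfold)
  moreover have "integrable (time_space T M) (\<lambda>(s, \<omega>). (norm (X s \<omega>))\<^sup>2)"
    "integrable (time_space T M) (\<lambda>(s, \<omega>). (norm (W s \<omega>))\<^sup>2)"
    using Xj[THEN L2_space_integrable_norm_sq] by (simp_all add: case_prod_unfold)
  moreover have "integrable (time_space T M) (\<lambda>_. 1::real)"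
    by (intro Fubini_integrable) auto
  ultimately have bound: "integrable (time_space T M) (\<lambda>z. 4 * C\<^sup>2 * (1 + (norm (X (fst z) (snd z)))\<^sup>2
      + (norm (W (fst z) (snd z)))\<^sup>2 + L2_inner M (X (fst z)) (X (fst z))))"
    by (simp add: case_prod_unfold)
  show "(\<lambda>(s, \<omega>). lift M F (X s) (W s) \<omega>) \<in> L2_space (time_space T M)"
  proof (rule L2_space_dominated[OF joint bound])
    fix z assume "z \<in> space (time_space T M)"
    then have "fst z \<in> {0..T}" by (auto simp: space_pair_measure space_restrict_space)
    then show "(norm (case z of (s, \<omega>) \<Rightarrow> lift M F (X s) (W s) \<omega>))\<^sup>2 \<le> 4 * C\<^sup>2 * (1 + (norm (X (fst z) (snd z)))\<^sup>2
      + (norm (W (fst z) (snd z)))\<^sup>2 + L2_inner M (X (fst z)) (X (fst z)))"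
      using norm_lift_sq_le[OF M XL(1) growth] by (simp add: case_prod_unfold)
  qed
  fix t assume t: "t \<in> {0..T}"
  show m: "lift M F (X t) (W t) \<in> borel_measurable (\<F> t)"
    using X W t by (intro lift_borel_measurable[OF M F XL(1)[OF t]]) (auto simp: adapted_L2_process_def)
  show "lift M F (X t) (W t) \<in> L2_space M"
  proof (rule L2_space_dominated)
    show "lift M F (X t) (W t) \<in> borel_measurable M"
      by (intro lift_borel_measurable[OF M F XL(1)[OF t]] L2_space_borel_measurable XL t)
    show "integrable M (\<lambda>\<omega>. 4 * C\<^sup>2 * (1 + (norm (X t \<omega>))\<^sup>2 + (norm (W t \<omega>))\<^sup>2 + L2_inner M (X t) (X t)))"
      using XL[OF t, THEN L2_space_integrable_norm_sq] by simp
  qed (rule norm_lift_sq_le[OF M XL(1)[OF t] growth])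
qed

section \<open>Strong solutions as drift plus orthogonal increments\<close>

lemma adapted_L2_process_diff:
  fixes a b :: "real \<Rightarrow> 'a \<Rightarrow> 'b::euclidean_space"
  assumes "adapted_L2_process M \<F> T a" "adapted_L2_process M \<F> T b"
  shows "adapted_L2_process M \<F> T (\<lambda>t \<omega>. a t \<omega> - b t \<omega>)"
  using assms L2_space_diff[of "\<lambda>(t, \<omega>). a t \<omega>" "time_space T M" "\<lambda>(t, \<omega>). b t \<omega>"]
  by (auto simp: adapted_L2_process_def case_prod_unfold
      intro!: L2_space_diff borel_measurable_diff)

lemma adapted_L2_process_AE_integrable_path:
  fixes a :: "real \<Rightarrow> 'a \<Rightarrow> 'b::euclidean_space"
  assumes M: "finite_measure M" and a: "adapted_L2_process M \<F> T a"
  shows "AE \<omega> in M. integrable (time_interval T) (\<lambda>t. a t \<omega>)"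
proof -
  have "AE \<omega> in M. (\<lambda>t. a t \<omega>) \<in> L2_space (time_interval T)"
    using a by (intro L2_process_AE_L2_path[OF finite_measure_time_interval M]) (simp add: adapted_L2_process_def)
  then show ?thesis
    by eventually_elim (rule L2_space_integrable[OF finite_measure_time_interval])
qed

text \<open>The difference of two solutions is treated as a process of the same kind; the drifts have to be
  integrable along almost every path for their time integrals to be subtracted.\<close>

lemma backward_decomposition_diff:
  fixes p q :: "real \<Rightarrow> 'a \<Rightarrow> 'b::euclidean_space"
  assumes M: "finite_measure M"
    and p: "backward_decomposition M \<F> T p a K" and q: "backward_decomposition M \<F> T q b J"
  shows "backward_decomposition M \<F> T (\<lambda>t \<omega>. p t \<omega> - q t \<omega>) (\<lambda>t \<omega>. a t \<omega> - b t \<omega>)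
    (\<lambda>t \<omega>. K t \<omega> - J t \<omega>)"
proof -
  let ?N = "time_interval T"
  have ab: "adapted_L2_process M \<F> T a" "adapted_L2_process M \<F> T b"
    using p q by (auto simp: backward_decomposition_def)
  have "AE \<omega> in M. (p t \<omega> - q t \<omega>) + ((K T \<omega> - J T \<omega>) - (K t \<omega> - J t \<omega>))
      = (p T \<omega> - q T \<omega>) + (LINT s:{t..T}|?N. a s \<omega> - b s \<omega>)" if t: "t \<in> {0..T}" for t
  proof -
    have "AE \<omega> in M. p t \<omega> + (K T \<omega> - K t \<omega>) = p T \<omega> + (LINT s:{t..T}|?N. a s \<omega>)"
      "AE \<omega> in M. q t \<omega> + (J T \<omega> - J t \<omega>) = q T \<omega> + (LINT s:{t..T}|?N. b s \<omega>)"
      using p q t by (auto simp: backward_decomposition_def)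
    moreover note adapted_L2_process_AE_integrable_path[OF M ab(1)]
      adapted_L2_process_AE_integrable_path[OF M ab(2)]
    ultimately show ?thesis
    proof eventually_elim
      case (elim \<omega>)
      have set: "{t..T} \<in> sets ?N" using t by (intro Icc_in_sets_time_interval) auto
      have "set_integrable ?N {t..T} (\<lambda>s. a s \<omega>)" "set_integrable ?N {t..T} (\<lambda>s. b s \<omega>)"
        unfolding set_integrable_def using elim set by (auto intro: integrable_mult_indicator)
      then have "(LINT s:{t..T}|?N. a s \<omega> - b s \<omega>)
          = (LINT s:{t..T}|?N. a s \<omega>) - (LINT s:{t..T}|?N. b s \<omega>)"
        by (rule set_integral_diff(2))
      moreover have "(p t \<omega> - q t \<omega>) + ((K T \<omega> - J T \<omega>) - (K t \<omega> - J t \<omega>))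
          = (p t \<omega> + (K T \<omega> - K t \<omega>)) - (q t \<omega> + (J T \<omega> - J t \<omega>))" by simp
      ultimately show ?case using elim by simp
    qed
  qed
  then show ?thesis
    using p q unfolding backward_decomposition_def
    by (auto intro: adapted_L2_process_diff orthogonal_future_increments_diff)
qed

lemma sq_integrable_adapted_adapted_L2_process:
  assumes "sq_integrable_adapted M \<F> T X" "\<And>t. t \<in> {0..T} \<Longrightarrow> X t \<in> L2_space M"
  shows "adapted_L2_process M \<F> T X"
  using assms by (auto simp: sq_integrable_adapted_def adapted_L2_process_def)

text \<open>Subtracting \<open>B 0\<close>, which is null only almost surely, makes the process square integrable directly
  from the law of the increments.\<close>

lemma brownian_orthogonal_future_increments:
  fixes B :: "real \<Rightarrow> 'a \<Rightarrow> real^'n"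
  assumes B: "brownian_motion M \<F> B"
  shows "orthogonal_future_increments M \<F> T (\<lambda>t \<omega>. \<sigma> *\<^sub>R (B t \<omega> - B 0 \<omega>))"
  unfolding orthogonal_future_increments_def
proof (intro ballI conjI allI impI)
  fix t assume t: "t \<in> {0..T}"
  then show "(\<lambda>\<omega>. \<sigma> *\<^sub>R (B t \<omega> - B 0 \<omega>)) \<in> L2_space M"
    by (intro L2_space_scaleR brownian_increment_L2[OF B]) auto
  fix Y :: "'a \<Rightarrow> real^'n" assume Y: "Y \<in> L2_space M \<and> Y \<in> borel_measurable (\<F> t)"
  have "L2_inner M (\<lambda>\<omega>. \<sigma> *\<^sub>R (B T \<omega> - B 0 \<omega>) - \<sigma> *\<^sub>R (B t \<omega> - B 0 \<omega>)) Y
      = \<sigma> * L2_inner M Y (\<lambda>\<omega>. B T \<omega> - B t \<omega>)"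
    by (simp add: L2_inner_def scaleR_diff_right[symmetric] inner_commute)
  also have "\<dots> = 0" using t Y brownian_increment_orthogonal[OF B, of t T Y] by simp
  finally show "L2_inner M (\<lambda>\<omega>. \<sigma> *\<^sub>R (B T \<omega> - B 0 \<omega>) - \<sigma> *\<^sub>R (B t \<omega> - B 0 \<omega>)) Y = 0" .
qed

text \<open>The forward equation, subtracted from itself at time \<open>T\<close>. The process \<open>K\<close> depends only on the
  noise, so it cancels in the difference of two solutions.\<close>

lemma strong_solution_forward_decomposition:
  fixes B :: "real \<Rightarrow> 'a \<Rightarrow> real^'n"
  assumes B: "brownian_motion M \<F> B" and T: "0 \<le> T"
    and sol: "strong_solution M \<F> B T \<sigma> W\<^sub>0 F G X\<^sub>0 X W Z"
    and f: "adapted_L2_process M \<F> T (\<lambda>s. lift M F (X s) (W s))"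
  shows "backward_decomposition M \<F> T X (\<lambda>s. lift M F (X s) (W s)) (\<lambda>t \<omega>. \<sigma> *\<^sub>R (B t \<omega> - B 0 \<omega>))"
proof -
  let ?N = "time_interval T" and ?f = "\<lambda>s. lift M F (X s) (W s)"
  have fin: "finite_measure M"
    using brownian_motionD(1)[OF B] by (simp add: prob_space_def)
  have X: "adapted_L2_process M \<F> T X"
    using sol by (intro sq_integrable_adapted_adapted_L2_process) (auto simp: strong_solution_def)
  have eq: "AE \<omega> in M. X t \<omega> = X\<^sub>0 \<omega> - (LINT s:{0..t}|?N. ?f s \<omega>) + \<sigma> *\<^sub>R B t \<omega>" if "t \<in> {0..T}" for t
  proof -
    have "(LINT s:{0..t}|?N. ?f s \<omega>) = (LINT s:{0..t}|lborel. ?f s \<omega>)" for \<omega>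
      using that by (intro set_integral_time_interval) auto
    then show ?thesis using sol that unfolding strong_solution_def by auto
  qed
  have "AE \<omega> in M. X t \<omega> + (\<sigma> *\<^sub>R (B T \<omega> - B 0 \<omega>) - \<sigma> *\<^sub>R (B t \<omega> - B 0 \<omega>))
      = X T \<omega> + (LINT s:{t..T}|?N. ?f s \<omega>)" if t: "t \<in> {0..T}" for t
  proof -
    have "T \<in> {0..T}" using T by simp
    from eq[OF t] eq[OF this] adapted_L2_process_AE_integrable_path[OF fin f]
    show ?thesis
    proof eventually_elim
      case (elim \<omega>)
      show ?case
        unfolding elim(1,2) set_integral_time_interval_split[OF elim(3) t]
        by (simp add: scaleR_diff_right)
    qed
  qed
  then show ?thesis
    using X f brownian_orthogonal_future_increments[OF B]
    by (auto simp: backward_decomposition_def)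
qed

text \<open>At \<open>t = T\<close> the equation reduces to the terminal condition, which can then be replaced by \<open>W T\<close> at
  all other times.\<close>

lemma strong_solution_backward_decomposition:
  fixes B :: "real \<Rightarrow> 'a \<Rightarrow> real^'n"
  assumes B: "brownian_motion M \<F> B" and T: "0 \<le> T"
    and sol: "strong_solution M \<F> B T \<sigma> W\<^sub>0 F G X\<^sub>0 X W Z"
    and g: "adapted_L2_process M \<F> T (\<lambda>s. lift M G (X s) (W s))"
  shows "(AE \<omega> in M. W T \<omega> = lift0 M W\<^sub>0 (X T) \<omega>) \<and>
    (\<exists>I. backward_decomposition M \<F> T W (\<lambda>s. lift M G (X s) (W s)) I)"
proof -
  let ?N = "time_interval T" and ?g = "\<lambda>s. lift M G (X s) (W s)"
  have W: "adapted_L2_process M \<F> T W"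
    using sol by (intro sq_integrable_adapted_adapted_L2_process) (auto simp: strong_solution_def)
  obtain I where I: "is_ito_integral M \<F> B T Z I"
    and eq: "\<And>t. t \<in> {0..T} \<Longrightarrow> AE \<omega> in M. W t \<omega> = lift0 M W\<^sub>0 (X T) \<omega>
      + (LINT s:{t..T}|lborel. ?g s \<omega>) - (I T \<omega> - I t \<omega>)"
    using sol unfolding strong_solution_def by blast
  have WT: "AE \<omega> in M. W T \<omega> = lift0 M W\<^sub>0 (X T) \<omega>"
    using eq[of T] T by (simp add: set_integral_singleton_lborel)
  have "AE \<omega> in M. W t \<omega> + (I T \<omega> - I t \<omega>) = W T \<omega> + (LINT s:{t..T}|?N. ?g s \<omega>)"
    if t: "t \<in> {0..T}" for t
  proof -
    have "(LINT s:{t..T}|?N. ?g s \<omega>) = (LINT s:{t..T}|lborel. ?g s \<omega>)" for \<omega>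
      using t by (intro set_integral_time_interval) auto
    note restrict = this
    show ?thesis using eq[OF t] WT by eventually_elim (simp add: restrict)
  qed
  then have "backward_decomposition M \<F> T W ?g I"
    using W g ito_integral_orthogonal_future_increments[OF B I]
    by (auto simp: backward_decomposition_def)
  with WT show ?thesis by blast
qed

section \<open>Stability\<close>

text \<open>The argument for the final bound, with \<open>v\<close> the backward and \<open>x\<close> the forward difference. The
  energy identity is used twice, for the pair \<open>(v, x)\<close>, where \<open>x\<close> has no martingale part, and for
  \<open>(v, v)\<close>, where the norm of the martingale increment has a favourable sign.\<close>

lemma backward_monotone_stability:
  fixes x v f g :: "real \<Rightarrow> 'a \<Rightarrow> 'b::euclidean_space"
  assumes M: "finite_measure M" and T: "0 \<le> T"
    and x: "backward_decomposition M \<F> T x f (\<lambda>_ _. 0)"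
    and v: "backward_decomposition M \<F> T v g K"
    and const: "0 < \<alpha>" "0 \<le> L" "0 < a" "0 \<le> c"
    and terminal: "a * (L2_norm M (v T))\<^sup>2 \<le> L2_inner M (v T) (x T)"
    and mono: "\<And>t. t \<in> {0..T} \<Longrightarrow> 0 \<le> L2_inner M (g t) (x t) + L2_inner M (f t) (v t)"
    and strong: "\<And>t. t \<in> {0..T} \<Longrightarrow> \<alpha> * (L2_norm M (x t))\<^sup>2 - L * (L2_norm M (v t))\<^sup>2
      \<le> L2_inner M (g t) (x t) + L2_inner M (f t) (v t)"
    and g_le: "\<And>t. t \<in> {0..T} \<Longrightarrow>
      L2_inner M (g t) (v t) \<le> c * ((L2_norm M (x t))\<^sup>2 + (L2_norm M (v t))\<^sup>2)"
    and t: "t \<in> {0..T}"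
  defines "C \<equiv> (1 / a + 2 * c / \<alpha>) * exp (2 * c * (1 + L / \<alpha>) * T)"
  shows "L2_norm M (v t) \<le> C * L2_norm M (x 0)"
proof -
  let ?N = "time_interval T"
  note N = finite_measure_time_interval
  define hx hv where "hx s = (L2_norm M (x s))\<^sup>2" and "hv s = (L2_norm M (v s))\<^sup>2" for s
  define m where "m s = L2_inner M (g s) (x s) + L2_inner M (f s) (v s)" for s
  define D where "D = L2_inner M (v 0) (x 0)"
  have L: "x s \<in> L2_space M" "v s \<in> L2_space M" if "s \<in> {0..T}" for s
    using x v that by (auto simp: backward_decomposition_def adapted_L2_process_def)
  have joint: "(\<lambda>(t, \<omega>). x t \<omega>) \<in> L2_space (?N \<Otimes>\<^sub>M M)" "(\<lambda>(t, \<omega>). v t \<omega>) \<in> L2_space (?N \<Otimes>\<^sub>M M)"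
    "(\<lambda>(t, \<omega>). f t \<omega>) \<in> L2_space (?N \<Otimes>\<^sub>M M)" "(\<lambda>(t, \<omega>). g t \<omega>) \<in> L2_space (?N \<Otimes>\<^sub>M M)"
    using x v by (auto simp: backward_decomposition_def adapted_L2_process_def)
  have int: "integrable ?N hx" "integrable ?N hv" "integrable ?N m"
    "integrable ?N (\<lambda>s. L2_inner M (g s) (v s))"
    unfolding hx_def hv_def m_def L2_norm_sq
    by (intro Bochner_Integration.integrable_add integrable_L2_inner_process[OF N M] joint)+
  have sint: "set_integrable ?N {s..T} h" if "integrable ?N h" "0 \<le> s" for h :: "real \<Rightarrow> real" and s
    unfolding set_integrable_def using that
    by (intro integrable_mult_indicator Icc_in_sets_time_interval)
  have hx0: "0 \<le> hx s" and hv0: "0 \<le> hv s" for s by (simp_all add: hx_def hv_def)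
  have nonneg: "0 \<le> (LINT s:{t..T}|?N. h s)" if "\<And>s. s \<in> {0..T} \<Longrightarrow> 0 \<le> h s" "0 \<le> t"
    for t and h :: "real \<Rightarrow> real"
    unfolding set_lebesgue_integral_def using that
    by (intro integral_nonneg_AE AE_I2) (auto simp: space_restrict_space split: split_indicator)
  have mono_int: "(LINT s:{t..T}|?N. h s) \<le> (LINT s:{t..T}|?N. k s)"
    if "integrable ?N h" "integrable ?N k" "\<And>s. s \<in> {0..T} \<Longrightarrow> h s \<le> k s" "0 \<le> t"
    for t and h k :: "real \<Rightarrow> real"
    using that by (intro set_integral_mono sint) auto
  have D_eq: "D = L2_inner M (v T) (x T) + (LINT s:{0..T}|?N. m s)"
    using energy_identity[OF M v x, of 0] T by (simp add: D_def m_def L2_inner_def)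
  \<comment> \<open>Monotonicity allows the part of the integral before \<open>t\<close> to be dropped, which transports the
    estimates from \<open>{0..T}\<close> to every \<open>{t..T}\<close>.\<close>
  have D_ge: "a * hv T + (LINT s:{t..T}|?N. m s) \<le> D" if t: "t \<in> {0..T}" for t
  proof -
    have "0 \<le> (LINT s:{0..t}|?N. m s)"
      unfolding set_lebesgue_integral_def using mono
      by (intro integral_nonneg_AE AE_I2) (auto simp: m_def space_restrict_space split: split_indicator)
    then have "(LINT s:{t..T}|?N. m s) \<le> (LINT s:{0..T}|?N. m s)"
      using set_integral_time_interval_split[OF int(3) t] by simp
    then show ?thesis using D_eq terminal by (simp add: hv_def)
  qed
  have hv_le: "hv t \<le> (1 / a + 2 * c / \<alpha>) * D + 2 * c * (1 + L / \<alpha>) * (LINT s:{t..T}|?N. hv s)"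
    if t: "t \<in> {0..T}" for t
  proof -
    have t0: "0 \<le> t" using t by simp
    let ?Ix = "LINT s:{t..T}|?N. hx s" and ?Iv = "LINT s:{t..T}|?N. hv s"
    have "hv T \<le> D / a"
      using D_ge[OF t] nonneg[of m t] mono t0 const by (simp add: m_def field_simps)
    moreover have "?Ix \<le> (D + L * ?Iv) / \<alpha>"
    proof -
      have "\<alpha> * ?Ix - L * ?Iv = (LINT s:{t..T}|?N. \<alpha> * hx s - L * hv s)"
        using sint[OF int(1) t0] sint[OF int(2) t0] by (simp add: set_integral_diff)
      also have "\<dots> \<le> (LINT s:{t..T}|?N. m s)"
        using strong[folded hx_def hv_def m_def] t0 int by (intro mono_int) auto
      also have "\<dots> \<le> D" using D_ge[OF t] const hv0[of T] by (smt (verit) mult_nonneg_nonneg)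
      finally show ?thesis using const by (simp add: field_simps)
    qed
    moreover have "hv t \<le> hv T + 2 * c * (?Ix + ?Iv)"
    proof -
      have "hv t \<le> hv t + L2_inner M (\<lambda>\<omega>. K T \<omega> - K t \<omega>) (\<lambda>\<omega>. K T \<omega> - K t \<omega>)"
        by (simp add: L2_inner_self_nonneg)
      also have "\<dots> = hv T + (LINT s:{t..T}|?N. L2_inner M (g s) (v s) + L2_inner M (g s) (v s))"
        using energy_identity[OF M v v t] by (simp add: hv_def L2_norm_sq)
      also have "\<dots> \<le> hv T + (LINT s:{t..T}|?N. 2 * c * (hx s + hv s))"
        using int g_le[folded hx_def hv_def] t0 by (intro add_left_mono mono_int) auto
      also have "(LINT s:{t..T}|?N. 2 * c * (hx s + hv s)) = 2 * c * (?Ix + ?Iv)"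
        using sint[OF int(1) t0] sint[OF int(2) t0] by (simp add: set_integral_add)
      finally show ?thesis .
    qed
    moreover have "2 * c * ?Ix \<le> 2 * c * ((D + L * ?Iv) / \<alpha>)"
      using calculation(2) const by (intro mult_left_mono) auto
    ultimately have "hv t \<le> D / a + 2 * c * ((D + L * ?Iv) / \<alpha>) + 2 * c * ?Iv"
      by (simp add: distrib_left)
    also have "\<dots> = (1 / a + 2 * c / \<alpha>) * D + 2 * c * (1 + L / \<alpha>) * ?Iv"
      using const by (simp add: field_simps)
    finally show ?thesis .
  qed
  have D0: "0 \<le> D"
    using D_ge[of 0] nonneg[of m 0] mono T const hv0[of T] by (smt (verit) atLeastAtMost_iff m_def mult_nonneg_nonneg)
  have C0: "0 \<le> C" using const by (simp add: C_def)
  have bound: "hv t \<le> C * D" if t: "t \<in> {0..T}" for t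
  proof -
    have k: "0 \<le> 2 * c * (1 + L / \<alpha>)" using const by simp
    have "hv t \<le> (1 / a + 2 * c / \<alpha>) * D * exp (2 * c * (1 + L / \<alpha>) * (T - t))"
      by (rule backward_gronwall[OF int(2) k hv_le t])
    also have "\<dots> \<le> (1 / a + 2 * c / \<alpha>) * D * exp (2 * c * (1 + L / \<alpha>) * T)"
      using const D0 t k by (intro mult_left_mono) (auto intro!: mult_left_mono)
    finally show ?thesis by (simp add: C_def mult_ac)
  qed
  have T0: "0 \<in> {0..T}" using T by simp
  have D_le: "D \<le> L2_norm M (v 0) * L2_norm M (x 0)"
    using L2_Cauchy_Schwarz[OF L(2)[OF T0] L(1)[OF T0]] by (simp add: D_def)
  \<comment> \<open>At time 0 the bound is quadratic in \<open>v 0\<close> on the left and linear on the right, so one factor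
    cancels.\<close>
  have v0: "L2_norm M (v 0) \<le> C * L2_norm M (x 0)"
  proof (cases "L2_norm M (v 0) = 0")
    case False
    then have pos: "0 < L2_norm M (v 0)" using L2_norm_nonneg[of M "v 0"] by simp
    have "L2_norm M (v 0) * L2_norm M (v 0) \<le> C * (L2_norm M (v 0) * L2_norm M (x 0))"
      using bound[OF T0] mult_left_mono[OF D_le C0] by (simp add: hv_def power2_eq_square)
    then have "L2_norm M (v 0) * L2_norm M (v 0) \<le> L2_norm M (v 0) * (C * L2_norm M (x 0))"
      by (simp add: mult_ac)
    then show ?thesis using pos by simp
  qed (simp add: C0 L2_norm_nonneg)
  have "hv t \<le> C * (L2_norm M (v 0) * L2_norm M (x 0))"
    using bound[OF t] mult_left_mono[OF D_le C0] by simp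
  also have "\<dots> \<le> C * (C * L2_norm M (x 0) * L2_norm M (x 0))"
    by (intro mult_left_mono mult_right_mono v0 C0 L2_norm_nonneg)
  also have "\<dots> = (C * L2_norm M (x 0))\<^sup>2" by (simp add: power2_eq_square)
  finally have "(L2_norm M (v t))\<^sup>2 \<le> (C * L2_norm M (x 0))\<^sup>2" by (simp add: hv_def)
  then show ?thesis by (rule power2_le_imp_le) (simp add: C0 L2_norm_nonneg)
qed

text \<open>The constant is that of \<open>backward_monotone_stability\<close>, with \<open>C\<^sub>2\<close> replaced by its positive part. The
  lifted assumptions are applied at each time to the random variables \<open>X s, Y s, Wx s, Wy s\<close>. The
  terminal condition holds almost surely and the initial values agree almost surely with the data,
  up to the common noise at time 0.\<close>

theorem lemma3p17:
  fixes M :: "'a measure"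
    and T :: real
    and W\<^sub>0 :: "real^'n \<Rightarrow> (real^'n) measure \<Rightarrow> real^'n"
    and F G :: "real^'n \<Rightarrow> (real^'n) measure \<Rightarrow> real^'n \<Rightarrow> real^'n"
    and C\<^sub>1 C\<^sub>2 \<alpha> L a\<^sub>0 \<gamma> :: real
    and w :: "real \<Rightarrow> real"
  assumes M: "prob_space M"
    and T: "T > 0"
    and cont: "continuous_P2 W\<^sub>0" "continuous_P2_2 F" "continuous_P2_2 G"
    and growth: "\<And>x \<mu> u. \<mu> \<in> P2 \<Longrightarrow>
      norm (W\<^sub>0 x \<mu>) + norm (F x \<mu> u) + norm (G x \<mu> u)
        \<le> C\<^sub>1 * (1 + norm x + norm u + sqrt (E2 \<mu>))"
    and constants: "\<alpha> > 0" "L \<ge> 0" "a\<^sub>0 > 0"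
    and mono_W0: "\<And>X Y. X \<in> L2_space M \<Longrightarrow> Y \<in> L2_space M \<Longrightarrow>
      L2_inner M (lift0 M W\<^sub>0 X - lift0 M W\<^sub>0 Y) (X - Y)
        \<ge> a\<^sub>0 * (L2_norm M (lift0 M W\<^sub>0 X - lift0 M W\<^sub>0 Y))\<^sup>2"
    and mono: "\<And>X Y U V. X \<in> L2_space M \<Longrightarrow> Y \<in> L2_space M \<Longrightarrow> U \<in> L2_space M \<Longrightarrow> V \<in> L2_space M \<Longrightarrow>
      L2_inner M (lift M G X U - lift M G Y V) (X - Y)
        + L2_inner M (lift M F X U - lift M F Y V) (U - V) \<ge> 0"
    and strong_mono: "\<And>X Y U V. X \<in> L2_space M \<Longrightarrow> Y \<in> L2_space M \<Longrightarrow> U \<in> L2_space M \<Longrightarrow> V \<in> L2_space M \<Longrightarrow>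
      L2_inner M (lift M G X U - lift M G Y V) (X - Y)
        + L2_inner M (lift M F X U - lift M F Y V) (U - V)
        \<ge> \<alpha> * (L2_norm M (X - Y))\<^sup>2 - L * (L2_norm M (U - V))\<^sup>2"
    and gamma: "0 < \<gamma>" "\<gamma> \<le> 1"
    and modulus: "modulus_of_continuity w"
    and G_bound: "\<And>X Y U V. X \<in> L2_space M \<Longrightarrow> Y \<in> L2_space M \<Longrightarrow> U \<in> L2_space M \<Longrightarrow> V \<in> L2_space M \<Longrightarrow>
      L2_inner M (lift M G X U - lift M G Y V) (U - V)
        \<le> C\<^sub>2 * ((L2_norm M (X - Y))\<^sup>2 + (L2_norm M (U - V))\<^sup>2)"
    and F_bound: "\<And>X Y U V. X \<in> L2_space M \<Longrightarrow> Y \<in> L2_space M \<Longrightarrow> U \<in> L2_space M \<Longrightarrow> V \<in> L2_space M \<Longrightarrow>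
      L2_inner M (lift M F X U - lift M F Y V) (X - Y)
        \<ge> - C\<^sub>2 * ((L2_norm M (X - Y))\<^sup>2 + (L2_norm_gamma M \<gamma> (U - V))\<^sup>2)"
    and measure_modulus: "\<And>x u \<mu> \<nu>. \<mu> \<in> P2 \<Longrightarrow> \<nu> \<in> P2 \<Longrightarrow>
      norm (F x \<mu> u - F x \<nu> u) + norm (G x \<mu> u - G x \<nu> u) + norm (W\<^sub>0 x \<mu> - W\<^sub>0 x \<nu>)
        \<le> w (W2 \<mu> \<nu>)"
  shows "\<exists>C. \<forall>\<sigma>\<^sub>x \<F> B X\<^sub>0 Y\<^sub>0 X Wx Zx Y Wy Zy.
    \<sigma>\<^sub>x \<ge> 0 \<and>
    brownian_motion M \<F> B \<and>
    X\<^sub>0 \<in> L2_space M \<and> X\<^sub>0 \<in> borel_measurable (\<F> 0) \<and>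
    Y\<^sub>0 \<in> L2_space M \<and> Y\<^sub>0 \<in> borel_measurable (\<F> 0) \<and>
    strong_solution M \<F> B T \<sigma>\<^sub>x W\<^sub>0 F G X\<^sub>0 X Wx Zx \<and>
    strong_solution M \<F> B T \<sigma>\<^sub>x W\<^sub>0 F G Y\<^sub>0 Y Wy Zy \<longrightarrow>
    (\<forall>t\<in>{0..T}. L2_norm M (Wx t - Wy t) \<le> C * L2_norm M (X\<^sub>0 - Y\<^sub>0))"
proof -
  interpret prob_space M by (rule M)
  have fin: "finite_measure M" by (rule finite_measure_axioms)
  define c where "c = max C\<^sub>2 0"
  define C where "C = (1 / a\<^sub>0 + 2 * c / \<alpha>) * exp (2 * c * (1 + L / \<alpha>) * T)"
  have growth_F: "norm (F x \<mu> u) \<le> C\<^sub>1 * (1 + norm x + norm u + sqrt (E2 \<mu>))"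
    and growth_G: "norm (G x \<mu> u) \<le> C\<^sub>1 * (1 + norm x + norm u + sqrt (E2 \<mu>))"
    if "\<mu> \<in> P2" for x u \<mu>
    using growth[OF that, of x u] norm_ge_zero[of "W\<^sub>0 x \<mu>"] norm_ge_zero[of "F x \<mu> u"]
      norm_ge_zero[of "G x \<mu> u"] by linarith+
  have "L2_norm M (Wx t - Wy t) \<le> C * L2_norm M (X\<^sub>0 - Y\<^sub>0)"
    if B: "brownian_motion M \<F> B"
      and ini: "X\<^sub>0 \<in> L2_space M" "Y\<^sub>0 \<in> L2_space M"
      and solX: "strong_solution M \<F> B T \<sigma>\<^sub>x W\<^sub>0 F G X\<^sub>0 X Wx Zx"
      and solY: "strong_solution M \<F> B T \<sigma>\<^sub>x W\<^sub>0 F G Y\<^sub>0 Y Wy Zy"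
      and t: "t \<in> {0..T}"
    for \<sigma>\<^sub>x \<F> B X\<^sub>0 Y\<^sub>0 X Wx Zx Y Wy Zy t
  proof -
    have T0: "0 \<le> T" "T \<in> {0..T}" "0 \<in> {0..T}" using T by auto
    have XL: "X s \<in> L2_space M" "Wx s \<in> L2_space M" "Y s \<in> L2_space M" "Wy s \<in> L2_space M"
      if "s \<in> {0..T}" for s
      using solX solY that by (auto simp: strong_solution_def)
    have lift_adapted: "adapted_L2_process M \<F> T (\<lambda>s. lift M F (X s) (W s))
        \<and> adapted_L2_process M \<F> T (\<lambda>s. lift M G (X s) (W s))"
      if sol: "strong_solution M \<F> B T \<sigma>\<^sub>x W\<^sub>0 F G X\<^sub>0 X W Z" for X\<^sub>0 X W Z
    proof -
      have p: "adapted_L2_process M \<F> T X" "adapted_L2_process M \<F> T W"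
        using sol by (auto simp: strong_solution_def intro!: sq_integrable_adapted_adapted_L2_process)
      have j: "(\<lambda>(s, \<omega>). lift M F (X s) (W s) \<omega>) \<in> borel_measurable (time_space T M)"
        "(\<lambda>(s, \<omega>). lift M G (X s) (W s) \<omega>) \<in> borel_measurable (time_space T M)"
        using sol by (auto simp: strong_solution_def)
      show ?thesis
        using adapted_L2_process_lift[OF M _ cont(2) growth_F p j(1)]
          adapted_L2_process_lift[OF M _ cont(3) growth_G p j(2)]
          brownian_motionD(2,3)[OF B] by auto
    qed
    let ?x = "\<lambda>s \<omega>. X s \<omega> - Y s \<omega>" and ?v = "\<lambda>s \<omega>. Wx s \<omega> - Wy s \<omega>"
    let ?f = "\<lambda>s \<omega>. lift M F (X s) (Wx s) \<omega> - lift M F (Y s) (Wy s) \<omega>"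
    let ?g = "\<lambda>s \<omega>. lift M G (X s) (Wx s) \<omega> - lift M G (Y s) (Wy s) \<omega>"
    have x: "backward_decomposition M \<F> T ?x ?f (\<lambda>_ _. 0)"
      using backward_decomposition_diff[OF fin
          strong_solution_forward_decomposition[OF B T0(1) solX conjunct1[OF lift_adapted[OF solX]]]
          strong_solution_forward_decomposition[OF B T0(1) solY conjunct1[OF lift_adapted[OF solY]]]]
      by simp
    obtain I J where "backward_decomposition M \<F> T Wx (\<lambda>s. lift M G (X s) (Wx s)) I"
      "backward_decomposition M \<F> T Wy (\<lambda>s. lift M G (Y s) (Wy s)) J"
      and WT: "AE \<omega> in M. Wx T \<omega> = lift0 M W\<^sub>0 (X T) \<omega>" "AE \<omega> in M. Wy T \<omega> = lift0 M W\<^sub>0 (Y T) \<omega>"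
      using strong_solution_backward_decomposition[OF B T0(1) solX conjunct2[OF lift_adapted[OF solX]]]
        strong_solution_backward_decomposition[OF B T0(1) solY conjunct2[OF lift_adapted[OF solY]]]
      by blast
    then have v: "backward_decomposition M \<F> T ?v ?g (\<lambda>t \<omega>. I t \<omega> - J t \<omega>)"
      by (intro backward_decomposition_diff[OF fin])
    let ?w = "\<lambda>\<omega>. lift0 M W\<^sub>0 (X T) \<omega> - lift0 M W\<^sub>0 (Y T) \<omega>"
    have wm: "?w \<in> borel_measurable M"
      by (intro borel_measurable_diff lift0_borel_measurable[OF M cont(1)] XL T0(2))
    have vm: "?v T \<in> borel_measurable M" and xm: "?x T \<in> borel_measurable M"
      by (intro borel_measurable_diff L2_space_borel_measurable XL T0(2))+
    have vw: "AE \<omega> in M. ?v T \<omega> = ?w \<omega>"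
      using WT by eventually_elim simp
    have "L2_inner M (?v T) (?x T) = L2_inner M ?w (?x T)"
      "L2_inner M (?v T) (?v T) = L2_inner M ?w ?w"
      by (intro L2_inner_cong_AE vw wm vm xm AE_I2 refl)+
    then have terminal: "a\<^sub>0 * (L2_norm M (?v T))\<^sup>2 \<le> L2_inner M (?v T) (?x T)"
      using mono_W0[OF XL(1,3)[OF T0(2)]] by (simp add: L2_norm_sq fun_diff_def)
    have initial: "L2_norm M (?x 0) = L2_norm M (X\<^sub>0 - Y\<^sub>0)"
    proof -
      have "AE \<omega> in M. X 0 \<omega> = X\<^sub>0 \<omega> + \<sigma>\<^sub>x *\<^sub>R B 0 \<omega>" "AE \<omega> in M. Y 0 \<omega> = Y\<^sub>0 \<omega> + \<sigma>\<^sub>x *\<^sub>R B 0 \<omega>"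
        using solX solY T0(3) by (auto simp: strong_solution_def set_integral_singleton_lborel
            dest!: bspec[where x=0])
      then have "AE \<omega> in M. ?x 0 \<omega> = X\<^sub>0 \<omega> - Y\<^sub>0 \<omega>" by eventually_elim simp
      then have "L2_inner M (?x 0) (?x 0) = L2_inner M (\<lambda>\<omega>. X\<^sub>0 \<omega> - Y\<^sub>0 \<omega>) (\<lambda>\<omega>. X\<^sub>0 \<omega> - Y\<^sub>0 \<omega>)"
        by (intro L2_inner_cong_AE L2_space_borel_measurable L2_space_diff XL ini T0(3))
      then show ?thesis by (simp add: L2_norm_def fun_diff_def)
    qed
    have "L2_norm M (?v t) \<le> C * L2_norm M (?x 0)"
      unfolding C_def
    proof (rule backward_monotone_stability[OF fin T0(1) x v constants _ terminal _ _ _ t])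
      show "0 \<le> c" by (simp add: c_def)
      fix s assume s: "s \<in> {0..T}"
      show "0 \<le> L2_inner M (?g s) (?x s) + L2_inner M (?f s) (?v s)"
        using mono[OF XL(1,3,2,4)[OF s]] by (simp add: fun_diff_def)
      show "\<alpha> * (L2_norm M (?x s))\<^sup>2 - L * (L2_norm M (?v s))\<^sup>2
          \<le> L2_inner M (?g s) (?x s) + L2_inner M (?f s) (?v s)"
        using strong_mono[OF XL(1,3,2,4)[OF s]] by (simp add: fun_diff_def)
      have "L2_inner M (?g s) (?v s) \<le> C\<^sub>2 * ((L2_norm M (?x s))\<^sup>2 + (L2_norm M (?v s))\<^sup>2)"
        using G_bound[OF XL(1,3,2,4)[OF s]] by (simp add: fun_diff_def)
      also have "\<dots> \<le> c * ((L2_norm M (?x s))\<^sup>2 + (L2_norm M (?v s))\<^sup>2)"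
        by (intro mult_right_mono) (auto simp: c_def)
      finally show "L2_inner M (?g s) (?v s) \<le> c * ((L2_norm M (?x s))\<^sup>2 + (L2_norm M (?v s))\<^sup>2)" .
    qed
    then show ?thesis unfolding initial by (simp add: fun_diff_def)
  qed
  then show ?thesis by (intro exI[of _ C]) blast
qed

end
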